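(* Let $(\mathcal G,\Lambda)$ be a self-similar action of a groupoid on a row-finite $k$-graph with no sources. Let $\varphi$ be a normalised total $\mathbb T$-valued $2$-cocycle on $(\mathcal G,\Lambda)$ and let $c:=\Psi^2(\varphi)$, i.e. the categorical $2$-cocycle on $\mathcal G\bowtie\Lambda$ given by $$c(\lambda g,\mu h)=\varphi_{2,0}(g\triangleleft\mu,h)\,\varphi_{1,1}(g,\mu)\,\varphi_{0,2}(\lambda,g\triangleright\mu).$$ (i) Let $t\colon\mathcal G\bowtie\Lambda\to\mathcal TC^*(\mathcal G,\Lambda;c)$ be the universal Toeplitz–Cuntz–Krieger $(\mathcal G,\Lambda;c)$-family. There is a Toeplitz $\varphi$-pair $\mathfrak t,\mathfrak w$ in $\mathcal TC^*(\mathcal G,\Lambda;c)$ given by $\mathfrak t=t|_\Lambda$ and $\mathfrak w=t|_{\mathcal G}$. Moreover $\mathcal TC^*(\mathcal G,\Lambda;c)$ is generated by the ranges of $\mathfrak t$ and $\mathfrak w$, and is universal in the sense that given any Toeplitz $\varphi$-pair $\mathfrak t',\mathfrak w'$ in a $C^*$-algebra $A$, there is a homomorphism $\rho\colon\mathcal TC^*(\mathcal G,\Lambda;c)\to A$ such that $\rho\circ\mathfrak t=\mathfrak t'$ and $\rho\circ\mathfrak w=\mathfrak w'$. (ii) Let $s\colon\mathcal G\bowtie\Lambda\to C^*(\mathcal G,\Lambda;c)$ be the universal Cuntz–Krieger $(\mathcal G,\Lambda;c)$-family. There is a Cuntz–Krieger $\varphi$-pair $\mathfrak s,\mathfrak u$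 in $C^*(\mathcal G,\Lambda;c)$ given by $\mathfrak s=s|_\Lambda$ and $\mathfrak u=s|_{\mathcal G}$. Moreover $C^*(\mathcal G,\Lambda;c)$ is generated by the ranges of $\mathfrak s$ and $\mathfrak u$, and is universal in the sense that given any Cuntz–Krieger $\varphi$-pair $\mathfrak s',\mathfrak u'$ in a $C^*$-algebra $A$, there is a homomorphism $\rho\colon C^*(\mathcal G,\Lambda;c)\to A$ such that $\rho\circ\mathfrak s=\mathfrak s'$ and $\rho\circ\mathfrak u=\mathfrak u'$.
   Context: A small category is identified with its set of morphisms; superscript $0$ denotes its identities (objects), $r,s$ codomain and domain, superscript $2$ its composable pairs. All groupoids are countable and discrete. Homomorphisms of $C^*$-algebras are $*$-homomorphisms. A $k$-graph is a countable category $\Lambda$ with a functor $d\colon\Lambda\to\mathbb N^k$ such that whenever $d(\lambda)=m+n$ there are unique $\mu,\nu\in\Lambda$ with $\lambda=\mu\nu$, $d(\mu)=m$, $d(\nu)=n$. $\Lambda^n=d^{-1}(n)$ for $n\in\mathbb N^k$ ($\Lambda^2$ in the domain of a cocycle means composable pairs), $v\Lambda^n=\{\lambda\in\Lambda^n:r(\lambda)=v\}$. $\Lambda$ is row-finite with no sources if $0<|v\Lambda^n|<\infty$ for all $v\in\Lambda^0,n\in\mathbb N^k$. $\mathrm{MCE}(\mu,\nu)=\mu\Lambda\cap\nu\Lambda\cap\Lambda^{d(\mu)\vee d(\nu)}$. A self-similar action of a groupoid $\mathcal G$ on a $k$-graph $\Lambda$ with $\mathcal G^0=\Lambda^0$ consists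 of a left action $\triangleright$ of $\mathcal G$ on $\Lambda$ and a right action $\triangleleft$ of $\Lambda$ on $\mathcal G$, both defined on $\mathcal G*\Lambda=\{(g,\lambda):s(g)=r(\lambda)\}$ with values in $\Lambda$, $\mathcal G$ respectively: $r(\lambda)\triangleright\lambda=\lambda$, $r(g\triangleright\lambda)=r(g)$, $(gh)\triangleright\lambda=g\triangleright(h\triangleright\lambda)$, $g\triangleright s(g)=r(g)$; $g\triangleleft s(g)=g$, $s(g\triangleleft\lambda)=s(\lambda)$, $g\triangleleft(\lambda\mu)=(g\triangleleft\lambda)\triangleleft\mu$, $r(\lambda)\triangleleft\lambda=s(\lambda)$; such that $s(g\triangleright\lambda)=r(g\triangleleft\lambda)$, $g\triangleright(\lambda\mu)=(g\triangleright\lambda)((g\triangleleft\lambda)\triangleright\mu)$, $(gh)\triangleleft\lambda=(g\triangleleft(h\triangleright\lambda))(h\triangleleft\lambda)$, and $d(g\triangleright\lambda)=d(\lambda)$. $\mathcal G\bowtie\Lambda$ is the category with morphisms $\lambda g:=(\lambda,g)$, $s(\lambda)=r(g)$; $r(\lambda g)=r(\lambda)$, $s(\lambda g)=s(g)$; $(\lambda g)(\mu h)=\lambda(g\triangleright\mu)\,(g\triangleleft\mu)h$; $\mathcal G,\Lambda$ are regarded as subcategories ($g=r(g)g$, $\lambda=\lambda s(\lambda)$). A normalised categorical $2$-cocycle on a category $\mathcal E$ is $c\colon\mathcal E^2\to\mathbb T$ with $c(\zeta,\eta)c(\zeta\eta,\theta)=c(\eta,\theta)c(\zeta,\eta\theta)$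 and $c(\zeta,\eta)=1$ if $\zeta$ or $\eta$ is an identity. A normalised total $\mathbb T$-valued $2$-cocycle on $(\mathcal G,\Lambda)$ is a function $\varphi\colon\mathcal G^2\sqcup(\mathcal G*\Lambda)\sqcup\Lambda^2\to\mathbb T$ (composable pairs), with restrictions $\varphi_{2,0},\varphi_{1,1},\varphi_{0,2}$, such that $\varphi_{2,0}$ and $\varphi_{0,2}$ are normalised $2$-cocycles on $\mathcal G$ and $\Lambda$, $\varphi_{1,1}(h,\lambda)=1$ if $h\in\mathcal G^0$ or $\lambda\in\Lambda^0$, and for composable $(g,h,\lambda,\mu)\in\mathcal G*\mathcal G*\Lambda*\Lambda$: $\varphi_{1,1}(h\triangleleft\lambda,\mu)\,\overline{\varphi_{1,1}(h,\lambda\mu)}\,\varphi_{1,1}(h,\lambda)\,\overline{\varphi_{0,2}(\lambda,\mu)}\,\varphi_{0,2}(h\triangleright\lambda,(h\triangleleft\lambda)\triangleright\mu)=1$ and $\varphi_{2,0}(g\triangleleft(h\triangleright\lambda),h\triangleleft\lambda)\,\overline{\varphi_{2,0}(g,h)}\,\varphi_{1,1}(h,\lambda)\,\overline{\varphi_{1,1}(gh,\lambda)}\,\varphi_{1,1}(g,h\triangleright\lambda)=1$ (equivalently, $\varphi$ is a normalised $2$-cocycle of the total complex of $(\mathcal G,\Lambda)$). A Toeplitz–Cuntz–Krieger $(\mathcal G,\Lambda;c)$-family in a $C^*$-algebra is a map $t$ on $\mathcal G\bowtie\Lambda$ with (TCK1) $t_\zeta t_\eta=c(\zeta,\eta)t_{\zeta\eta}$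 if $s(\zeta)=r(\eta)$ and $0$ otherwise; (TCK2) $t_\zeta^*t_\zeta=t_{s(\zeta)}$; (TCK3) $t_\mu t_\mu^*t_\nu t_\nu^*=\sum_{\lambda\in\mathrm{MCE}(\mu,\nu)}t_\lambda t_\lambda^*$ for $\mu,\nu\in\Lambda$; it is Cuntz–Krieger if also (CK) $t_v=\sum_{\lambda\in v\Lambda^n}t_\lambda t_\lambda^*$ for all $v\in\Lambda^0,n\in\mathbb N^k$. $\mathcal TC^*(\mathcal G,\Lambda;c)$ and $C^*(\mathcal G,\Lambda;c)$ are the $C^*$-algebras generated by universal such families. A Toeplitz $\varphi$-pair in $A$ is a pair of maps $\mathfrak t\colon\Lambda\to A$, $\mathfrak w\colon\mathcal G\to A$ such that (T1) $\mathfrak t$ is a Toeplitz–Cuntz–Krieger $(\Lambda,\varphi_{0,2})$-family (the $\mathfrak t_v$, $v\in\Lambda^0$, are mutually orthogonal projections, $\mathfrak t_\mu\mathfrak t_\nu=\varphi_{0,2}(\mu,\nu)\mathfrak t_{\mu\nu}$ for composable $\mu,\nu$, $\mathfrak t_\lambda^*\mathfrak t_\lambda=\mathfrak t_{s(\lambda)}$, and (TCK3)); (T2) $\mathfrak w$ is a unitary representation of $(\mathcal G,\varphi_{2,0})$ ($\mathfrak w_g\mathfrak w_h=\varphi_{2,0}(g,h)\mathfrak w_{gh}$ if $s(g)=r(h)$ and $0$ otherwise, $\mathfrak w_g^*=\overline{\varphi_{2,0}(g,g^{-1})}\mathfrak w_{g^{-1}}$); (T3) $\mathfrak w_g\mathfrak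 t_\lambda=\varphi_{1,1}(g,\lambda)\mathfrak t_{g\triangleright\lambda}\mathfrak w_{g\triangleleft\lambda}$ for all $(g,\lambda)\in\mathcal G*\Lambda$. It is a Cuntz–Krieger $\varphi$-pair if $\mathfrak t$ is moreover a Cuntz–Krieger $(\Lambda,\varphi_{0,2})$-family, i.e. also satisfies (CK).
   Formalization: A Toeplitz (or Cuntz–Krieger) φ-pair is additionally required to satisfy 𝔴_v = 𝔱_v for all v in 𝒢⁰ = Λ⁰; without this the universal property fails (e.g. one-morphism category, A = ℂ, 𝔱_v = 1, 𝔴_v = 0). *)

theory Defs
  imports "HOL-Analysis.Analysis" "HOL-Algebra.Ring" "HOL-Library.Function_Algebras"
begin

section \<open>\<open>C\<^sup>*\<close>-algebras\<close>

text \<open>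
  A \<open>C\<^sup>*\<close>-algebra is an algebra with an explicit carrier, so that one can quantify over the
  \<open>C\<^sup>*\<close>-algebras carried by subsets of a type.  Algebras need not be unital: the field
  \<^const>\<open>one\<close> inherited from the ring records of HOL-Algebra is unconstrained and never used.
\<close>

record 'a cstar = "'a ring" +
  scl :: "complex \<Rightarrow> 'a \<Rightarrow> 'a"
  adj :: "'a \<Rightarrow> 'a"
  nrm :: "'a \<Rightarrow> real"

text \<open>The value off the carrier is irrelevant; it makes the library's locale \<open>Metric_space\<close> apply.\<close>

definition cdist :: "('a, 'z) cstar_scheme \<Rightarrow> 'a \<Rightarrow> 'a \<Rightarrow> real" where
  "cdist A x y = (if x \<in> carrier A \<and> y \<in> carrier A then nrm A (x \<ominus>\<^bsub>A\<^esub> y) else 0)"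

locale cstar_algebra = abelian_group A for A :: "('a, 'z) cstar_scheme" (structure) +
  assumes mult_closed: "\<lbrakk>x \<in> carrier A; y \<in> carrier A\<rbrakk> \<Longrightarrow> x \<otimes> y \<in> carrier A"
    and mult_assoc: "\<lbrakk>x \<in> carrier A; y \<in> carrier A; z \<in> carrier A\<rbrakk>
      \<Longrightarrow> (x \<otimes> y) \<otimes> z = x \<otimes> (y \<otimes> z)"
    and distr_left: "\<lbrakk>x \<in> carrier A; y \<in> carrier A; z \<in> carrier A\<rbrakk>
      \<Longrightarrow> (x \<oplus> y) \<otimes> z = (x \<otimes> z) \<oplus> (y \<otimes> z)"
    and distr_right: "\<lbrakk>x \<in> carrier A; y \<in> carrier A; z \<in> carrier A\<rbrakk>
      \<Longrightarrow> z \<otimes> (x \<oplus> y) = (z \<otimes> x) \<oplus> (z \<otimes> y)"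
    and scl_closed: "x \<in> carrier A \<Longrightarrow> scl A a x \<in> carrier A"
    and scl_one: "x \<in> carrier A \<Longrightarrow> scl A 1 x = x"
    and scl_scl: "x \<in> carrier A \<Longrightarrow> scl A a (scl A b x) = scl A (a * b) x"
    and scl_add: "x \<in> carrier A \<Longrightarrow> scl A (a + b) x = scl A a x \<oplus> scl A b x"
    and scl_sum: "\<lbrakk>x \<in> carrier A; y \<in> carrier A\<rbrakk>
      \<Longrightarrow> scl A a (x \<oplus> y) = scl A a x \<oplus> scl A a y"
    and scl_mult_left: "\<lbrakk>x \<in> carrier A; y \<in> carrier A\<rbrakk> \<Longrightarrow> scl A a x \<otimes> y = scl A a (x \<otimes> y)"
    and scl_mult_right: "\<lbrakk>x \<in> carrier A; y \<in> carrier A\<rbrakk> \<Longrightarrow> x \<otimes> scl A a y = scl A a (x \<otimes> y)"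
    and adj_closed: "x \<in> carrier A \<Longrightarrow> adj A x \<in> carrier A"
    and adj_adj: "x \<in> carrier A \<Longrightarrow> adj A (adj A x) = x"
    and adj_sum: "\<lbrakk>x \<in> carrier A; y \<in> carrier A\<rbrakk> \<Longrightarrow> adj A (x \<oplus> y) = adj A x \<oplus> adj A y"
    and adj_scl: "x \<in> carrier A \<Longrightarrow> adj A (scl A a x) = scl A (cnj a) (adj A x)"
    and adj_mult: "\<lbrakk>x \<in> carrier A; y \<in> carrier A\<rbrakk> \<Longrightarrow> adj A (x \<otimes> y) = adj A y \<otimes> adj A x"
    and nrm_nonneg: "x \<in> carrier A \<Longrightarrow> 0 \<le> nrm A x"
    and nrm_eq_0: "x \<in> carrier A \<Longrightarrow> nrm A x = 0 \<longleftrightarrow> x = \<zero>"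
    and nrm_triangle: "\<lbrakk>x \<in> carrier A; y \<in> carrier A\<rbrakk> \<Longrightarrow> nrm A (x \<oplus> y) \<le> nrm A x + nrm A y"
    and nrm_scl: "x \<in> carrier A \<Longrightarrow> nrm A (scl A a x) = cmod a * nrm A x"
    and nrm_mult: "\<lbrakk>x \<in> carrier A; y \<in> carrier A\<rbrakk> \<Longrightarrow> nrm A (x \<otimes> y) \<le> nrm A x * nrm A y"
    and cstar_identity: "x \<in> carrier A \<Longrightarrow> nrm A (adj A x \<otimes> x) = (nrm A x)\<^sup>2"
    and complete: "Metric_space.mcomplete (carrier A) (cdist A)"

lemma (in cstar_algebra) cdist_Metric_space: "Metric_space (carrier A) (cdist A)"
proof
  have neg: "nrm A (\<ominus> x) = nrm A x" if x: "x \<in> carrier A" for x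
  proof -
    have z: "scl A 0 x = \<zero>"
      using scl_add[OF x, of 0 0] scl_closed[OF x, of 0] by (metis add.r_cancel_one' add_0)
    have "x \<oplus> scl A (-1) x = \<zero>"
      using scl_add[OF x, of 1 "-1"] z scl_one[OF x] by simp
    then have "\<ominus> x = scl A (-1) x"
      using x scl_closed[OF x] by (metis minus_equality a_comm)
    then show ?thesis using nrm_scl[OF x, of "-1"] by simp
  qed
  show "0 \<le> cdist A x y" for x y
    by (simp add: cdist_def nrm_nonneg minus_eq)
  show "cdist A x y = cdist A y x" for x y
  proof -
    have "x \<ominus> y = \<ominus> (y \<ominus> x)" if "x \<in> carrier A" "y \<in> carrier A"
      using that by (simp add: minus_eq minus_add a_comm)
    then show ?thesis by (auto simp: cdist_def neg)
  qed
  show "cdist A x y = 0 \<longleftrightarrow> x = y" if "x \<in> carrier A" "y \<in> carrier A" for x y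
  proof -
    have "x \<ominus> y = \<zero> \<longleftrightarrow> x = y"
      using that by (metis a_inv_closed minus_eq minus_equality minus_minus r_neg)
    then show ?thesis using that nrm_eq_0[of "x \<ominus> y"] by (simp add: cdist_def)
  qed
  show "cdist A x z \<le> cdist A x y + cdist A y z"
    if "x \<in> carrier A" "y \<in> carrier A" "z \<in> carrier A" for x y z
  proof -
    have "x \<ominus> z = (x \<ominus> y) \<oplus> (y \<ominus> z)"
      using that by (simp add: minus_eq a_ac r_neg1 r_neg2)
    then show ?thesis using that nrm_triangle[of "x \<ominus> y" "y \<ominus> z"] by (simp add: cdist_def)
  qed
qed

definition cstar_subalgebra :: "('a, 'z) cstar_scheme \<Rightarrow> 'a set \<Rightarrow> bool" where
  "cstar_subalgebra A S \<longleftrightarrow> S \<subseteq> carrier A \<and> \<zero>\<^bsub>A\<^esub> \<in> S \<and>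
     (\<forall>x\<in>S. \<forall>y\<in>S. x \<oplus>\<^bsub>A\<^esub> y \<in> S \<and> x \<otimes>\<^bsub>A\<^esub> y \<in> S) \<and>
     (\<forall>x\<in>S. \<forall>a. scl A a x \<in> S) \<and> (\<forall>x\<in>S. adj A x \<in> S) \<and>
     closedin (Metric_space.mtopology (carrier A) (cdist A)) S"

definition cstar_generated :: "('a, 'z) cstar_scheme \<Rightarrow> 'a set \<Rightarrow> 'a set" where
  "cstar_generated A X = \<Inter>{S. cstar_subalgebra A S \<and> X \<subseteq> S}"

definition star_hom :: "('a, 'y) cstar_scheme \<Rightarrow> ('b, 'z) cstar_scheme \<Rightarrow> ('a \<Rightarrow> 'b) \<Rightarrow> bool" where
  "star_hom A B \<rho> \<longleftrightarrow> \<rho> \<in> carrier A \<rightarrow> carrier B \<and>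
     (\<forall>x\<in>carrier A. \<forall>y\<in>carrier A.
        \<rho> (x \<oplus>\<^bsub>A\<^esub> y) = \<rho> x \<oplus>\<^bsub>B\<^esub> \<rho> y \<and> \<rho> (x \<otimes>\<^bsub>A\<^esub> y) = \<rho> x \<otimes>\<^bsub>B\<^esub> \<rho> y) \<and>
     (\<forall>x\<in>carrier A. \<forall>a. \<rho> (scl A a x) = scl B a (\<rho> x)) \<and>
     (\<forall>x\<in>carrier A. \<rho> (adj A x) = adj B (\<rho> x))"


section \<open>Categories, groupoids and \<open>k\<close>-graphs\<close>

text \<open>
  Small categories are identified with their sets of morphisms, and objects with their identity
  morphisms.  As in functional notation, \<open>x \<cdot> y\<close> is defined when \<open>src x = rng y\<close>.
\<close>

record 'm cat =
  mor :: "'m set"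
  src :: "'m \<Rightarrow> 'm"
  rng :: "'m \<Rightarrow> 'm"
  cmp :: "'m \<Rightarrow> 'm \<Rightarrow> 'm" (infixl "\<cdot>\<index>" 70)

definition obj :: "('m, 'z) cat_scheme \<Rightarrow> 'm set" where
  "obj C = src C ` mor C"

locale small_category = fixes C :: "('m, 'z) cat_scheme" (structure)
  assumes src_closed: "x \<in> mor C \<Longrightarrow> src C x \<in> mor C"
    and rng_closed: "x \<in> mor C \<Longrightarrow> rng C x \<in> mor C"
    and src_src: "x \<in> mor C \<Longrightarrow> src C (src C x) = src C x"
    and rng_src: "x \<in> mor C \<Longrightarrow> rng C (src C x) = src C x"
    and src_rng: "x \<in> mor C \<Longrightarrow> src C (rng C x) = rng C x"
    and rng_rng: "x \<in> mor C \<Longrightarrow> rng C (rng C x) = rng C x"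
    and cmp_closed: "\<lbrakk>x \<in> mor C; y \<in> mor C; src C x = rng C y\<rbrakk> \<Longrightarrow> x \<cdot> y \<in> mor C"
    and src_cmp: "\<lbrakk>x \<in> mor C; y \<in> mor C; src C x = rng C y\<rbrakk> \<Longrightarrow> src C (x \<cdot> y) = src C y"
    and rng_cmp: "\<lbrakk>x \<in> mor C; y \<in> mor C; src C x = rng C y\<rbrakk> \<Longrightarrow> rng C (x \<cdot> y) = rng C x"
    and cmp_assoc: "\<lbrakk>x \<in> mor C; y \<in> mor C; z \<in> mor C; src C x = rng C y; src C y = rng C z\<rbrakk>
      \<Longrightarrow> (x \<cdot> y) \<cdot> z = x \<cdot> (y \<cdot> z)"
    and cmp_rng: "x \<in> mor C \<Longrightarrow> rng C x \<cdot> x = x"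
    and cmp_src: "x \<in> mor C \<Longrightarrow> x \<cdot> src C x = x"

definition is_inverse :: "('m, 'z) cat_scheme \<Rightarrow> 'm \<Rightarrow> 'm \<Rightarrow> bool" where
  "is_inverse C g h \<longleftrightarrow> h \<in> mor C \<and> src C h = rng C g \<and> rng C h = src C g \<and>
     g \<cdot>\<^bsub>C\<^esub> h = rng C g \<and> h \<cdot>\<^bsub>C\<^esub> g = src C g"

definition minv :: "('m, 'z) cat_scheme \<Rightarrow> 'm \<Rightarrow> 'm" where
  "minv C g = (THE h. is_inverse C g h)"

locale groupoid = small_category G for G :: "('m, 'z) cat_scheme" (structure) +
  assumes countable_mor: "countable (mor G)"
    and invertible: "g \<in> mor G \<Longrightarrow> \<exists>h. is_inverse G g h"

text \<open>
  Elements of \<open>\<nat>\<^sup>k\<close> are functions \<open>nat \<Rightarrow> nat\<close> vanishing at all indices \<open>\<ge> k\<close>, with pointwise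
  addition and pointwise maximum \<^const>\<open>sup\<close>.
\<close>

definition Nvec :: "nat \<Rightarrow> (nat \<Rightarrow> nat) set" where
  "Nvec k = {n. \<forall>i\<ge>k. n i = 0}"

record 'm kgraph = "'m cat" +
  rank :: nat
  deg :: "'m \<Rightarrow> nat \<Rightarrow> nat"

locale k_graph = small_category \<Lambda> for \<Lambda> :: "('m, 'z) kgraph_scheme" (structure) +
  assumes countable_mor: "countable (mor \<Lambda>)"
    and deg_closed: "x \<in> mor \<Lambda> \<Longrightarrow> deg \<Lambda> x \<in> Nvec (rank \<Lambda>)"
    and deg_obj: "v \<in> obj \<Lambda> \<Longrightarrow> deg \<Lambda> v = 0"
    and deg_cmp: "\<lbrakk>x \<in> mor \<Lambda>; y \<in> mor \<Lambda>; src \<Lambda> x = rng \<Lambda> y\<rbrakk>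
      \<Longrightarrow> deg \<Lambda> (x \<cdot> y) = deg \<Lambda> x + deg \<Lambda> y"
    and factorisation: "\<lbrakk>x \<in> mor \<Lambda>; m \<in> Nvec (rank \<Lambda>); n \<in> Nvec (rank \<Lambda>); deg \<Lambda> x = m + n\<rbrakk>
      \<Longrightarrow> \<exists>!p. p \<in> {(\<mu>, \<nu>). \<mu> \<in> mor \<Lambda> \<and> \<nu> \<in> mor \<Lambda> \<and> src \<Lambda> \<mu> = rng \<Lambda> \<nu> \<and>
            x = \<mu> \<cdot> \<nu> \<and> deg \<Lambda> \<mu> = m \<and> deg \<Lambda> \<nu> = n}"

definition paths_with_rng :: "('m, 'z) kgraph_scheme \<Rightarrow> 'm \<Rightarrow> (nat \<Rightarrow> nat) \<Rightarrow> 'm set" where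
  "paths_with_rng \<Lambda> v n = {x \<in> mor \<Lambda>. deg \<Lambda> x = n \<and> rng \<Lambda> x = v}"

definition row_finite_no_sources :: "('m, 'z) kgraph_scheme \<Rightarrow> bool" where
  "row_finite_no_sources \<Lambda> \<longleftrightarrow>
     (\<forall>v\<in>obj \<Lambda>. \<forall>n\<in>Nvec (rank \<Lambda>). finite (paths_with_rng \<Lambda> v n) \<and> paths_with_rng \<Lambda> v n \<noteq> {})"

definition extensions :: "('m, 'z) cat_scheme \<Rightarrow> 'm \<Rightarrow> 'm set" where
  "extensions C \<mu> = {\<mu> \<cdot>\<^bsub>C\<^esub> \<alpha> | \<alpha>. \<alpha> \<in> mor C \<and> src C \<mu> = rng C \<alpha>}"

definition MCE :: "('m, 'z) kgraph_scheme \<Rightarrow> 'm \<Rightarrow> 'm \<Rightarrow> 'm set" where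
  "MCE \<Lambda> \<mu> \<nu> = extensions \<Lambda> \<mu> \<inter> extensions \<Lambda> \<nu> \<inter>
     {x \<in> mor \<Lambda>. deg \<Lambda> x = sup (deg \<Lambda> \<mu>) (deg \<Lambda> \<nu>)}"


section \<open>Self-similar actions and the Zappa--Szep product category\<close>

text \<open>\<open>act g x\<close> is the left action \<open>g \<triangleright> x\<close> and \<open>res g x\<close> the right action \<open>g \<triangleleft> x\<close>.\<close>

locale self_similar_action = G: groupoid G + L: k_graph \<Lambda>
  for G :: "'m cat" and \<Lambda> :: "'m kgraph" and act res :: "'m \<Rightarrow> 'm \<Rightarrow> 'm" +
  assumes same_objects: "obj G = obj \<Lambda>"
    and act_closed: "\<lbrakk>g \<in> mor G; x \<in> mor \<Lambda>; src G g = rng \<Lambda> x\<rbrakk> \<Longrightarrow> act g x \<in> mor \<Lambda>"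
    and res_closed: "\<lbrakk>g \<in> mor G; x \<in> mor \<Lambda>; src G g = rng \<Lambda> x\<rbrakk> \<Longrightarrow> res g x \<in> mor G"
    and act_rng: "x \<in> mor \<Lambda> \<Longrightarrow> act (rng \<Lambda> x) x = x"
    and rng_act: "\<lbrakk>g \<in> mor G; x \<in> mor \<Lambda>; src G g = rng \<Lambda> x\<rbrakk> \<Longrightarrow> rng \<Lambda> (act g x) = rng G g"
    and act_cmp: "\<lbrakk>g \<in> mor G; h \<in> mor G; x \<in> mor \<Lambda>; src G g = rng G h; src G h = rng \<Lambda> x\<rbrakk>
      \<Longrightarrow> act (g \<cdot>\<^bsub>G\<^esub> h) x = act g (act h x)"
    and act_src: "g \<in> mor G \<Longrightarrow> act g (src G g) = rng G g"
    and res_src: "g \<in> mor G \<Longrightarrow> res g (src G g) = g"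
    and src_res: "\<lbrakk>g \<in> mor G; x \<in> mor \<Lambda>; src G g = rng \<Lambda> x\<rbrakk> \<Longrightarrow> src G (res g x) = src \<Lambda> x"
    and res_cmp: "\<lbrakk>g \<in> mor G; x \<in> mor \<Lambda>; y \<in> mor \<Lambda>; src G g = rng \<Lambda> x; src \<Lambda> x = rng \<Lambda> y\<rbrakk>
      \<Longrightarrow> res g (x \<cdot>\<^bsub>\<Lambda>\<^esub> y) = res (res g x) y"
    and res_rng: "x \<in> mor \<Lambda> \<Longrightarrow> res (rng \<Lambda> x) x = src \<Lambda> x"
    and src_act: "\<lbrakk>g \<in> mor G; x \<in> mor \<Lambda>; src G g = rng \<Lambda> x\<rbrakk>
      \<Longrightarrow> src \<Lambda> (act g x) = rng G (res g x)"
    and act_product: "\<lbrakk>g \<in> mor G; x \<in> mor \<Lambda>; y \<in> mor \<Lambda>; src G g = rng \<Lambda> x; src \<Lambda> x = rng \<Lambda> y\<rbrakk>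
      \<Longrightarrow> act g (x \<cdot>\<^bsub>\<Lambda>\<^esub> y) = act g x \<cdot>\<^bsub>\<Lambda>\<^esub> act (res g x) y"
    and res_product: "\<lbrakk>g \<in> mor G; h \<in> mor G; x \<in> mor \<Lambda>; src G g = rng G h; src G h = rng \<Lambda> x\<rbrakk>
      \<Longrightarrow> res (g \<cdot>\<^bsub>G\<^esub> h) x = res g (act h x) \<cdot>\<^bsub>G\<^esub> res h x"
    and deg_act: "\<lbrakk>g \<in> mor G; x \<in> mor \<Lambda>; src G g = rng \<Lambda> x\<rbrakk> \<Longrightarrow> deg \<Lambda> (act g x) = deg \<Lambda> x"

definition ZS :: "'m cat \<Rightarrow> 'm kgraph \<Rightarrow> ('m \<Rightarrow> 'm \<Rightarrow> 'm) \<Rightarrow> ('m \<Rightarrow> 'm \<Rightarrow> 'm) \<Rightarrow> ('m \<times> 'm) cat" where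
  "ZS G \<Lambda> act res = \<lparr>
     mor = {(x, g). x \<in> mor \<Lambda> \<and> g \<in> mor G \<and> src \<Lambda> x = rng G g},
     src = (\<lambda>(x, g). (src G g, src G g)),
     rng = (\<lambda>(x, g). (rng \<Lambda> x, rng \<Lambda> x)),
     cmp = (\<lambda>(x, g) (y, h). (x \<cdot>\<^bsub>\<Lambda>\<^esub> act g y, res g y \<cdot>\<^bsub>G\<^esub> h)) \<rparr>"

definition incl_grpd :: "'m cat \<Rightarrow> 'm \<Rightarrow> 'm \<times> 'm" where
  "incl_grpd G g = (rng G g, g)"

definition incl_graph :: "'m kgraph \<Rightarrow> 'm \<Rightarrow> 'm \<times> 'm" where
  "incl_graph \<Lambda> x = (x, src \<Lambda> x)"


section \<open>Cocycles\<close>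

definition normalised_2_cocycle :: "('m, 'z) cat_scheme \<Rightarrow> ('m \<Rightarrow> 'm \<Rightarrow> complex) \<Rightarrow> bool" where
  "normalised_2_cocycle C c \<longleftrightarrow>
     (\<forall>x\<in>mor C. \<forall>y\<in>mor C. src C x = rng C y \<longrightarrow> c x y \<in> sphere 0 1) \<and>
     (\<forall>x\<in>mor C. \<forall>y\<in>mor C. \<forall>z\<in>mor C. src C x = rng C y \<and> src C y = rng C z \<longrightarrow>
        c x y * c (x \<cdot>\<^bsub>C\<^esub> y) z = c y z * c x (y \<cdot>\<^bsub>C\<^esub> z)) \<and>
     (\<forall>x\<in>mor C. \<forall>y\<in>mor C. src C x = rng C y \<and> (x \<in> obj C \<or> y \<in> obj C) \<longrightarrow> c x y = 1)"

text \<open>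
  A function on the disjoint union of the three sets of composable pairs is given by its three
  restrictions \<open>\<phi>\<^sub>2\<^sub>,\<^sub>0\<close>, \<open>\<phi>\<^sub>1\<^sub>,\<^sub>1\<close>, \<open>\<phi>\<^sub>0\<^sub>,\<^sub>2\<close>; values at non-composable pairs are irrelevant.
\<close>

record 'm total_cochain =
  phi20 :: "'m \<Rightarrow> 'm \<Rightarrow> complex"
  phi11 :: "'m \<Rightarrow> 'm \<Rightarrow> complex"
  phi02 :: "'m \<Rightarrow> 'm \<Rightarrow> complex"

definition normalised_total_2_cocycle ::
  "'m cat \<Rightarrow> 'm kgraph \<Rightarrow> ('m \<Rightarrow> 'm \<Rightarrow> 'm) \<Rightarrow> ('m \<Rightarrow> 'm \<Rightarrow> 'm) \<Rightarrow> 'm total_cochain \<Rightarrow> bool" where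
  "normalised_total_2_cocycle G \<Lambda> act res \<phi> \<longleftrightarrow>
     normalised_2_cocycle G (phi20 \<phi>) \<and> normalised_2_cocycle \<Lambda> (phi02 \<phi>) \<and>
     (\<forall>h\<in>mor G. \<forall>x\<in>mor \<Lambda>. src G h = rng \<Lambda> x \<longrightarrow>
        phi11 \<phi> h x \<in> sphere 0 1 \<and> (h \<in> obj G \<or> x \<in> obj \<Lambda> \<longrightarrow> phi11 \<phi> h x = 1)) \<and>
     (\<forall>g\<in>mor G. \<forall>h\<in>mor G. \<forall>x\<in>mor \<Lambda>. \<forall>y\<in>mor \<Lambda>.
        src G g = rng G h \<and> src G h = rng \<Lambda> x \<and> src \<Lambda> x = rng \<Lambda> y \<longrightarrow>
        phi11 \<phi> (res h x) y * cnj (phi11 \<phi> h (x \<cdot>\<^bsub>\<Lambda>\<^esub> y)) * phi11 \<phi> h x *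
          cnj (phi02 \<phi> x y) * phi02 \<phi> (act h x) (act (res h x) y) = 1 \<and>
        phi20 \<phi> (res g (act h x)) (res h x) * cnj (phi20 \<phi> g h) * phi11 \<phi> h x *
          cnj (phi11 \<phi> (g \<cdot>\<^bsub>G\<^esub> h) x) * phi11 \<phi> g (act h x) = 1)"

definition Psi2 :: "('m \<Rightarrow> 'm \<Rightarrow> 'm) \<Rightarrow> ('m \<Rightarrow> 'm \<Rightarrow> 'm) \<Rightarrow> 'm total_cochain
    \<Rightarrow> 'm \<times> 'm \<Rightarrow> 'm \<times> 'm \<Rightarrow> complex" where
  "Psi2 act res \<phi> = (\<lambda>(x, g) (y, h).
     phi20 \<phi> (res g y) h * phi11 \<phi> g y * phi02 \<phi> x (act g y))"


lemma cancel_units: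
  fixes p q r a b :: complex
  assumes "a * a' = 1" "b * b' = 1" "p * a' * q * b' * r = 1"
  shows "p * q * r = a * b"
proof -
  have "p * q * r = (p * q * r) * (a * a') * (b * b')" using assms by simp
  also have "\<dots> = (p * a' * q * b' * r) * (a * b)" by (simp add: mult_ac)
  finally show ?thesis using assms by simp
qed

context self_similar_action begin

lemma obj_iff_G: "v \<in> obj G \<longleftrightarrow> v \<in> mor G \<and> src G v = v"
  unfolding obj_def using G.src_closed G.src_src by force
lemma obj_iff_L: "v \<in> obj \<Lambda> \<longleftrightarrow> v \<in> mor \<Lambda> \<and> src \<Lambda> v = v"
  unfolding obj_def using L.src_closed L.src_src by force

lemma objG: "v \<in> obj G \<Longrightarrow> v \<in> mor G \<and> src G v = v \<and> rng G v = v \<and> v \<in> mor \<Lambda> \<and> src \<Lambda> v = v \<and> rng \<Lambda> v = v"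
  by (metis G.rng_src L.rng_src obj_iff_G obj_iff_L same_objects)

lemma ends_obj: "g \<in> mor G \<Longrightarrow> src G g \<in> obj G" "g \<in> mor G \<Longrightarrow> rng G g \<in> obj G"
  "x \<in> mor \<Lambda> \<Longrightarrow> src \<Lambda> x \<in> obj G" "x \<in> mor \<Lambda> \<Longrightarrow> rng \<Lambda> x \<in> obj G"
     apply (simp add: obj_iff_G G.src_closed G.src_src)
    apply (simp add: obj_iff_G G.rng_closed G.src_rng)
   apply (simp add: same_objects obj_iff_L L.src_closed L.src_src)
  apply (simp add: same_objects obj_iff_L L.rng_closed L.src_rng)
  done

lemma src_objL: "x \<in> mor \<Lambda> \<Longrightarrow> src \<Lambda> x \<in> obj \<Lambda>" "x \<in> mor \<Lambda> \<Longrightarrow> rng \<Lambda> x \<in> obj \<Lambda>"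
  using ends_obj same_objects by auto

lemmas ends = ends_obj[THEN objG, THEN conjunct1] ends_obj[THEN objG, THEN conjunct2]

lemma ZS_category: "small_category (ZS G \<Lambda> act res)"
proof
  let ?E = "ZS G \<Lambda> act res"
  show "(p \<cdot>\<^bsub>?E\<^esub> q) \<cdot>\<^bsub>?E\<^esub> r = p \<cdot>\<^bsub>?E\<^esub> (q \<cdot>\<^bsub>?E\<^esub> r)"
    if "p \<in> mor ?E" "q \<in> mor ?E" "r \<in> mor ?E" "src ?E p = rng ?E q" "src ?E q = rng ?E r" for p q r
    using that by (cases p; cases q; cases r) 
      (simp add: ZS_def L.cmp_closed G.cmp_closed L.cmp_assoc G.cmp_assoc act_closed res_closed rng_act src_act src_res
         act_product res_product act_cmp res_cmp)
qed (auto simp: ZS_def ends L.cmp_closed L.src_cmp L.rng_cmp G.cmp_closed G.src_cmp G.rng_cmp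
      act_closed res_closed rng_act src_act src_res act_rng res_rng act_src res_src 
       G.cmp_rng G.cmp_src L.cmp_rng dest: L.cmp_src)

lemma Psi2_cocycle:
  assumes "normalised_total_2_cocycle G \<Lambda> act res \<phi>"
  shows "normalised_2_cocycle (ZS G \<Lambda> act res) (Psi2 act res \<phi>)"
proof -
  note N = assms[unfolded normalised_total_2_cocycle_def normalised_2_cocycle_def]
  let ?E = "ZS G \<Lambda> act res"
  have u20: "\<lbrakk>g \<in> mor G; h \<in> mor G; src G g = rng G h\<rbrakk> \<Longrightarrow> cmod (phi20 \<phi> g h) = 1" for g h
    using N by simp
  have u02: "\<lbrakk>x \<in> mor \<Lambda>; y \<in> mor \<Lambda>; src \<Lambda> x = rng \<Lambda> y\<rbrakk> \<Longrightarrow> cmod (phi02 \<phi> x y) = 1" for x y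
    using N by simp
  have u11: "\<lbrakk>g \<in> mor G; x \<in> mor \<Lambda>; src G g = rng \<Lambda> x\<rbrakk> \<Longrightarrow> cmod (phi11 \<phi> g x) = 1" for g x
    using N by simp
  have c20: "\<lbrakk>x \<in> mor G; y \<in> mor G; z \<in> mor G; src G x = rng G y; src G y = rng G z\<rbrakk> \<Longrightarrow>
    phi20 \<phi> x y * phi20 \<phi> (x \<cdot>\<^bsub>G\<^esub> y) z = phi20 \<phi> y z * phi20 \<phi> x (y \<cdot>\<^bsub>G\<^esub> z)" for x y z
    using N by blast
  have c02: "\<lbrakk>x \<in> mor \<Lambda>; y \<in> mor \<Lambda>; z \<in> mor \<Lambda>; src \<Lambda> x = rng \<Lambda> y; src \<Lambda> y = rng \<Lambda> z\<rbrakk> \<Longrightarrow>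
    phi02 \<phi> x y * phi02 \<phi> (x \<cdot>\<^bsub>\<Lambda>\<^esub> y) z = phi02 \<phi> y z * phi02 \<phi> x (y \<cdot>\<^bsub>\<Lambda>\<^esub> z)" for x y z
    using N by blast
  have n20: "\<lbrakk>g \<in> mor G; h \<in> mor G; src G g = rng G h; g \<in> obj G \<or> h \<in> obj G\<rbrakk> \<Longrightarrow> phi20 \<phi> g h = 1" for g h
    using N by blast
  have n02: "\<lbrakk>x \<in> mor \<Lambda>; y \<in> mor \<Lambda>; src \<Lambda> x = rng \<Lambda> y; x \<in> obj \<Lambda> \<or> y \<in> obj \<Lambda>\<rbrakk> \<Longrightarrow> phi02 \<phi> x y = 1" for x y
    using N by blast
  have n11: "\<lbrakk>g \<in> mor G; x \<in> mor \<Lambda>; src G g = rng \<Lambda> x; g \<in> obj G \<or> x \<in> obj \<Lambda>\<rbrakk> \<Longrightarrow> phi11 \<phi> g x = 1" for g x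
    using N by blast
  have cj: "z * cnj z = 1" if "cmod z = 1" for z
    using that by (metis complex_norm_square of_real_1 power_one)
  have m1: "phi11 \<phi> (res h x) y * phi11 \<phi> h x * phi02 \<phi> (act h x) (act (res h x) y)
      = phi11 \<phi> h (x \<cdot>\<^bsub>\<Lambda>\<^esub> y) * phi02 \<phi> x y"
    if "h \<in> mor G" "x \<in> mor \<Lambda>" "y \<in> mor \<Lambda>" "src G h = rng \<Lambda> x" "src \<Lambda> x = rng \<Lambda> y" for h x y
  proof -
    have g: "rng G h \<in> mor G" "src G (rng G h) = rng G h" using that ends by auto
    have e: "phi11 \<phi> (res h x) y * cnj (phi11 \<phi> h (x \<cdot>\<^bsub>\<Lambda>\<^esub> y)) * phi11 \<phi> h x *
          cnj (phi02 \<phi> x y) * phi02 \<phi> (act h x) (act (res h x) y) = 1"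
      using N g that by blast
    have a: "phi11 \<phi> h (x \<cdot>\<^bsub>\<Lambda>\<^esub> y) * cnj (phi11 \<phi> h (x \<cdot>\<^bsub>\<Lambda>\<^esub> y)) = 1"
      "phi02 \<phi> x y * cnj (phi02 \<phi> x y) = 1"
      using that by (auto intro!: cj u11 u02 simp: L.cmp_closed L.rng_cmp)
    show ?thesis using cancel_units[OF a e] .
  qed
  have m2: "phi20 \<phi> (res g (act h x)) (res h x) * phi11 \<phi> h x * phi11 \<phi> g (act h x)
      = phi20 \<phi> g h * phi11 \<phi> (g \<cdot>\<^bsub>G\<^esub> h) x"
    if "g \<in> mor G" "h \<in> mor G" "x \<in> mor \<Lambda>" "src G g = rng G h" "src G h = rng \<Lambda> x" for g h x
  proof -
    have y: "src \<Lambda> x \<in> mor \<Lambda>" "rng \<Lambda> (src \<Lambda> x) = src \<Lambda> x" using that ends by auto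
    have e: "phi20 \<phi> (res g (act h x)) (res h x) * cnj (phi20 \<phi> g h) * phi11 \<phi> h x *
          cnj (phi11 \<phi> (g \<cdot>\<^bsub>G\<^esub> h) x) * phi11 \<phi> g (act h x) = 1"
      using N y that by metis
    have a: "phi20 \<phi> g h * cnj (phi20 \<phi> g h) = 1"
      "phi11 \<phi> (g \<cdot>\<^bsub>G\<^esub> h) x * cnj (phi11 \<phi> (g \<cdot>\<^bsub>G\<^esub> h) x) = 1"
      using that by (auto intro!: cj u11 u20 simp: G.cmp_closed G.src_cmp)
    show ?thesis using cancel_units[OF a e] .
  qed
  have P1: "Psi2 act res \<phi> \<zeta> \<eta> \<in> sphere 0 1" if "\<zeta> \<in> mor ?E" "\<eta> \<in> mor ?E" "src ?E \<zeta> = rng ?E \<eta>" for \<zeta> \<eta>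
    using that by (auto simp: ZS_def Psi2_def norm_mult u20 u11 u02 res_closed act_closed src_res rng_act)
  have P3: "Psi2 act res \<phi> \<zeta> \<eta> = 1"
    if z: "\<zeta> \<in> mor ?E" "\<eta> \<in> mor ?E" "src ?E \<zeta> = rng ?E \<eta>" and o: "\<zeta> \<in> obj ?E \<or> \<eta> \<in> obj ?E" for \<zeta> \<eta>
  proof -
    obtain x g y h where s: "\<zeta> = (x, g)" "\<eta> = (y, h)" by fastforce
    have o': "(x \<in> obj G \<and> g = x) \<or> (y \<in> obj G \<and> h = y)"
      using o ends_obj unfolding s obj_def[of ?E] by (auto simp: ZS_def)
    show ?thesis using o'
    proof
      assume "x \<in> obj G \<and> g = x"
      moreover from this have "x = rng \<Lambda> y" using z s objG by (auto simp: ZS_def)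
      moreover have "src \<Lambda> y = rng G h" "y \<in> mor \<Lambda>" "h \<in> mor G" using z s by (auto simp: ZS_def)
      ultimately show ?thesis unfolding s Psi2_def
        by (auto simp: act_rng res_rng ends ends_obj src_objL n20 n11 n02)
    next
      assume "y \<in> obj G \<and> h = y"
      moreover from this have "y = src G g" using z s objG by (auto simp: ZS_def)
      moreover have "src \<Lambda> x = rng G g" "x \<in> mor \<Lambda>" "g \<in> mor G" using z s by (auto simp: ZS_def)
      ultimately show ?thesis unfolding s Psi2_def
        by (auto simp: act_src res_src ends ends_obj src_objL n20 n11 n02 same_objects[symmetric])
    qed
  qed
  have P2: "Psi2 act res \<phi> \<zeta> \<eta> * Psi2 act res \<phi> (\<zeta> \<cdot>\<^bsub>?E\<^esub> \<eta>) \<theta> =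
      Psi2 act res \<phi> \<eta> \<theta> * Psi2 act res \<phi> \<zeta> (\<eta> \<cdot>\<^bsub>?E\<^esub> \<theta>)"
    if m: "\<zeta> \<in> mor ?E" "\<eta> \<in> mor ?E" "\<theta> \<in> mor ?E" "src ?E \<zeta> = rng ?E \<eta>" "src ?E \<eta> = rng ?E \<theta>" for \<zeta> \<eta> \<theta>
  proof -
    obtain x g y h z k where s: "\<zeta> = (x, g)" "\<eta> = (y, h)" "\<theta> = (z, k)" by (metis surj_pair)
    have r: "x \<in> mor \<Lambda>" "y \<in> mor \<Lambda>" "z \<in> mor \<Lambda>" "g \<in> mor G" "h \<in> mor G" "k \<in> mor G"
      "src \<Lambda> x = rng G g" "src \<Lambda> y = rng G h" "src \<Lambda> z = rng G k" "src G g = rng \<Lambda> y" "src G h = rng \<Lambda> z"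
      using m unfolding s ZS_def by auto
    define g' z' h' a where d1: "g' = res g y" "z' = act h z" "h' = res h z" "a = act g y"
    define b g'' where d2: "b = act g' z'" "g'' = res g' z'"
    have q: "g' \<in> mor G" "z' \<in> mor \<Lambda>" "h' \<in> mor G" "a \<in> mor \<Lambda>" "src G g' = rng G h" "rng G g' = src \<Lambda> a"
       "rng \<Lambda> z' = rng G h" "src \<Lambda> z' = rng G h'" "src G h' = rng G k" "rng \<Lambda> a = rng G g"
      unfolding d1 using r by (auto simp: res_closed act_closed src_res src_act rng_act)
    have q2: "b \<in> mor \<Lambda>" "g'' \<in> mor G" "src G g'' = rng G h'" "rng \<Lambda> b = src \<Lambda> a"
      unfolding d2 using q by (auto simp: res_closed act_closed src_res src_act rng_act)
    have e1: "act (g' \<cdot>\<^bsub>G\<^esub> h) z = b" "res (g' \<cdot>\<^bsub>G\<^esub> h) z = g'' \<cdot>\<^bsub>G\<^esub> h'"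
      using r q by (auto simp: act_cmp res_product d2 d1(2,3))
    have e2: "act g (y \<cdot>\<^bsub>\<Lambda>\<^esub> z') = a \<cdot>\<^bsub>\<Lambda>\<^esub> b" "res g (y \<cdot>\<^bsub>\<Lambda>\<^esub> z') = g''"
      using r q by (auto simp: act_product res_cmp d2 d1(1,4))
    have f1: "phi20 \<phi> g'' h' * phi20 \<phi> (g'' \<cdot>\<^bsub>G\<^esub> h') k = phi20 \<phi> h' k * phi20 \<phi> g'' (h' \<cdot>\<^bsub>G\<^esub> k)"
      using r q q2 by (intro c20) auto
    have f2: "phi02 \<phi> x a * phi02 \<phi> (x \<cdot>\<^bsub>\<Lambda>\<^esub> a) b = phi02 \<phi> a b * phi02 \<phi> x (a \<cdot>\<^bsub>\<Lambda>\<^esub> b)"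
      using r q q2 by (intro c02) auto
    have f3: "phi11 \<phi> g' z' * phi11 \<phi> g y * phi02 \<phi> a b = phi11 \<phi> g (y \<cdot>\<^bsub>\<Lambda>\<^esub> z') * phi02 \<phi> y z'"
      using m1[of g y z'] r q unfolding d2 d1(1,4) by auto
    have f4: "phi20 \<phi> g'' h' * phi11 \<phi> h z * phi11 \<phi> g' z' = phi20 \<phi> g' h * phi11 \<phi> (g' \<cdot>\<^bsub>G\<^esub> h) z"
      using m2[of g' h z] r q unfolding d2 d1(2,3) by auto
    have nz: "phi20 \<phi> g'' h' \<noteq> 0" using u20[of g'' h'] q q2 by auto
    have L: "Psi2 act res \<phi> \<zeta> \<eta> * Psi2 act res \<phi> (\<zeta> \<cdot>\<^bsub>?E\<^esub> \<eta>) \<theta> =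
       phi20 \<phi> g' h * phi11 \<phi> g y * phi02 \<phi> x a *
       (phi20 \<phi> (g'' \<cdot>\<^bsub>G\<^esub> h') k * phi11 \<phi> (g' \<cdot>\<^bsub>G\<^esub> h) z * phi02 \<phi> (x \<cdot>\<^bsub>\<Lambda>\<^esub> a) b)"
      unfolding s by (simp add: Psi2_def ZS_def e1 flip: d1)
    have R: "Psi2 act res \<phi> \<eta> \<theta> * Psi2 act res \<phi> \<zeta> (\<eta> \<cdot>\<^bsub>?E\<^esub> \<theta>) =
       phi20 \<phi> h' k * phi11 \<phi> h z * phi02 \<phi> y z' *
       (phi20 \<phi> g'' (h' \<cdot>\<^bsub>G\<^esub> k) * phi11 \<phi> g (y \<cdot>\<^bsub>\<Lambda>\<^esub> z') * phi02 \<phi> x (a \<cdot>\<^bsub>\<Lambda>\<^esub> b))"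
      unfolding s by (simp add: Psi2_def ZS_def e2 flip: d1)
    have "phi20 \<phi> g'' h' * (phi20 \<phi> g' h * phi11 \<phi> g y * phi02 \<phi> x a *
       (phi20 \<phi> (g'' \<cdot>\<^bsub>G\<^esub> h') k * phi11 \<phi> (g' \<cdot>\<^bsub>G\<^esub> h) z * phi02 \<phi> (x \<cdot>\<^bsub>\<Lambda>\<^esub> a) b))
      = (phi20 \<phi> g' h * phi11 \<phi> (g' \<cdot>\<^bsub>G\<^esub> h) z) * phi11 \<phi> g y *
        (phi02 \<phi> x a * phi02 \<phi> (x \<cdot>\<^bsub>\<Lambda>\<^esub> a) b) * (phi20 \<phi> g'' h' * phi20 \<phi> (g'' \<cdot>\<^bsub>G\<^esub> h') k)"
      by simp
    also have "\<dots> = phi20 \<phi> g'' h' * phi11 \<phi> h z * (phi11 \<phi> g' z' * phi11 \<phi> g y * phi02 \<phi> a b) *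
        phi02 \<phi> x (a \<cdot>\<^bsub>\<Lambda>\<^esub> b) * (phi20 \<phi> h' k * phi20 \<phi> g'' (h' \<cdot>\<^bsub>G\<^esub> k))"
      unfolding f1 f2 f4[symmetric] by simp
    also have "\<dots> = phi20 \<phi> g'' h' * (phi20 \<phi> h' k * phi11 \<phi> h z * phi02 \<phi> y z' *
       (phi20 \<phi> g'' (h' \<cdot>\<^bsub>G\<^esub> k) * phi11 \<phi> g (y \<cdot>\<^bsub>\<Lambda>\<^esub> z') * phi02 \<phi> x (a \<cdot>\<^bsub>\<Lambda>\<^esub> b)))"
      unfolding f3 by simp
    finally show ?thesis using nz unfolding L R by simp
  qed
  show ?thesis unfolding normalised_2_cocycle_def using P1 P2 P3 by blast
qed
end


section \<open>Families in \<open>C\<^sup>*\<close>-algebras\<close>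

definition range_proj :: "('a, 'z) cstar_scheme \<Rightarrow> 'a \<Rightarrow> 'a" where
  "range_proj A x = x \<otimes>\<^bsub>A\<^esub> adj A x"

definition TCK3 :: "('m, 'y) kgraph_scheme \<Rightarrow> ('a, 'z) cstar_scheme \<Rightarrow> ('m \<Rightarrow> 'a) \<Rightarrow> bool" where
  "TCK3 \<Lambda> A t \<longleftrightarrow> (\<forall>\<mu>\<in>mor \<Lambda>. \<forall>\<nu>\<in>mor \<Lambda>.
     range_proj A (t \<mu>) \<otimes>\<^bsub>A\<^esub> range_proj A (t \<nu>) =
       (\<Oplus>\<^bsub>A\<^esub>x\<in>MCE \<Lambda> \<mu> \<nu>. range_proj A (t x)))"

definition CK :: "('m, 'y) kgraph_scheme \<Rightarrow> ('a, 'z) cstar_scheme \<Rightarrow> ('m \<Rightarrow> 'a) \<Rightarrow> bool" where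
  "CK \<Lambda> A t \<longleftrightarrow> (\<forall>v\<in>obj \<Lambda>. \<forall>n\<in>Nvec (rank \<Lambda>).
     t v = (\<Oplus>\<^bsub>A\<^esub>x\<in>paths_with_rng \<Lambda> v n. range_proj A (t x)))"

definition TCK_family :: "'m cat \<Rightarrow> 'm kgraph \<Rightarrow> ('m \<Rightarrow> 'm \<Rightarrow> 'm) \<Rightarrow> ('m \<Rightarrow> 'm \<Rightarrow> 'm)
    \<Rightarrow> ('m \<times> 'm \<Rightarrow> 'm \<times> 'm \<Rightarrow> complex) \<Rightarrow> 'a cstar \<Rightarrow> ('m \<times> 'm \<Rightarrow> 'a) \<Rightarrow> bool" where
  "TCK_family G \<Lambda> act res c A t \<longleftrightarrow> (let E = ZS G \<Lambda> act res in
     t \<in> mor E \<rightarrow> carrier A \<and>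
     (\<forall>\<zeta>\<in>mor E. \<forall>\<eta>\<in>mor E. t \<zeta> \<otimes>\<^bsub>A\<^esub> t \<eta> =
        (if src E \<zeta> = rng E \<eta> then scl A (c \<zeta> \<eta>) (t (\<zeta> \<cdot>\<^bsub>E\<^esub> \<eta>)) else \<zero>\<^bsub>A\<^esub>)) \<and>
     (\<forall>\<zeta>\<in>mor E. adj A (t \<zeta>) \<otimes>\<^bsub>A\<^esub> t \<zeta> = t (src E \<zeta>)) \<and>
     TCK3 \<Lambda> A (\<lambda>x. t (incl_graph \<Lambda> x)))"

definition CK_family :: "'m cat \<Rightarrow> 'm kgraph \<Rightarrow> ('m \<Rightarrow> 'm \<Rightarrow> 'm) \<Rightarrow> ('m \<Rightarrow> 'm \<Rightarrow> 'm)
    \<Rightarrow> ('m \<times> 'm \<Rightarrow> 'm \<times> 'm \<Rightarrow> complex) \<Rightarrow> 'a cstar \<Rightarrow> ('m \<times> 'm \<Rightarrow> 'a) \<Rightarrow> bool" where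
  "CK_family G \<Lambda> act res c A t \<longleftrightarrow>
     TCK_family G \<Lambda> act res c A t \<and> CK \<Lambda> A (\<lambda>x. t (incl_graph \<Lambda> x))"

text \<open>
  \<open>(B, t)\<close> is the \<open>C\<^sup>*\<close>-algebra generated by a universal family.  HOL cannot quantify over types
  inside a formula, so the universal property is stated for the \<open>C\<^sup>*\<close>-algebras carried by subsets
  of \<^typ>\<open>'a\<close>; the type \<^typ>\<open>'a\<close> is an explicit parameter and is independent of the type
  carrying \<open>B\<close>.
\<close>

definition universal_TCK_family :: "'a itself \<Rightarrow> 'm cat \<Rightarrow> 'm kgraph
    \<Rightarrow> ('m \<Rightarrow> 'm \<Rightarrow> 'm) \<Rightarrow> ('m \<Rightarrow> 'm \<Rightarrow> 'm) \<Rightarrow> ('m \<times> 'm \<Rightarrow> 'm \<times> 'm \<Rightarrow> complex)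
    \<Rightarrow> 'b cstar \<Rightarrow> ('m \<times> 'm \<Rightarrow> 'b) \<Rightarrow> bool" where
  "universal_TCK_family (_ :: 'a itself) G \<Lambda> act res c B t \<longleftrightarrow>
     cstar_algebra B \<and> TCK_family G \<Lambda> act res c B t \<and>
     cstar_generated B (t ` mor (ZS G \<Lambda> act res)) = carrier B \<and>
     (\<forall>(A :: 'a cstar) t'. cstar_algebra A \<and> TCK_family G \<Lambda> act res c A t' \<longrightarrow>
        (\<exists>\<rho>. star_hom B A \<rho> \<and> (\<forall>\<zeta>\<in>mor (ZS G \<Lambda> act res). \<rho> (t \<zeta>) = t' \<zeta>)))"

definition universal_CK_family :: "'a itself \<Rightarrow> 'm cat \<Rightarrow> 'm kgraph
    \<Rightarrow> ('m \<Rightarrow> 'm \<Rightarrow> 'm) \<Rightarrow> ('m \<Rightarrow> 'm \<Rightarrow> 'm) \<Rightarrow> ('m \<times> 'm \<Rightarrow> 'm \<times> 'm \<Rightarrow> complex)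
    \<Rightarrow> 'b cstar \<Rightarrow> ('m \<times> 'm \<Rightarrow> 'b) \<Rightarrow> bool" where
  "universal_CK_family (_ :: 'a itself) G \<Lambda> act res c B t \<longleftrightarrow>
     cstar_algebra B \<and> CK_family G \<Lambda> act res c B t \<and>
     cstar_generated B (t ` mor (ZS G \<Lambda> act res)) = carrier B \<and>
     (\<forall>(A :: 'a cstar) t'. cstar_algebra A \<and> CK_family G \<Lambda> act res c A t' \<longrightarrow>
        (\<exists>\<rho>. star_hom B A \<rho> \<and> (\<forall>\<zeta>\<in>mor (ZS G \<Lambda> act res). \<rho> (t \<zeta>) = t' \<zeta>)))"

definition graph_TCK_family ::
  "'m kgraph \<Rightarrow> ('m \<Rightarrow> 'm \<Rightarrow> complex) \<Rightarrow> 'a cstar \<Rightarrow> ('m \<Rightarrow> 'a) \<Rightarrow> bool" where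
  "graph_TCK_family \<Lambda> c A t \<longleftrightarrow>
     t \<in> mor \<Lambda> \<rightarrow> carrier A \<and>
     (\<forall>v\<in>obj \<Lambda>. adj A (t v) = t v \<and> t v \<otimes>\<^bsub>A\<^esub> t v = t v) \<and>
     (\<forall>v\<in>obj \<Lambda>. \<forall>w\<in>obj \<Lambda>. v \<noteq> w \<longrightarrow> t v \<otimes>\<^bsub>A\<^esub> t w = \<zero>\<^bsub>A\<^esub>) \<and>
     (\<forall>\<mu>\<in>mor \<Lambda>. \<forall>\<nu>\<in>mor \<Lambda>. src \<Lambda> \<mu> = rng \<Lambda> \<nu> \<longrightarrow>
        t \<mu> \<otimes>\<^bsub>A\<^esub> t \<nu> = scl A (c \<mu> \<nu>) (t (\<mu> \<cdot>\<^bsub>\<Lambda>\<^esub> \<nu>))) \<and>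
     (\<forall>x\<in>mor \<Lambda>. adj A (t x) \<otimes>\<^bsub>A\<^esub> t x = t (src \<Lambda> x)) \<and>
     TCK3 \<Lambda> A t"

definition unitary_rep ::
  "'m cat \<Rightarrow> ('m \<Rightarrow> 'm \<Rightarrow> complex) \<Rightarrow> 'a cstar \<Rightarrow> ('m \<Rightarrow> 'a) \<Rightarrow> bool" where
  "unitary_rep G c A w \<longleftrightarrow>
     w \<in> mor G \<rightarrow> carrier A \<and>
     (\<forall>g\<in>mor G. \<forall>h\<in>mor G. w g \<otimes>\<^bsub>A\<^esub> w h =
        (if src G g = rng G h then scl A (c g h) (w (g \<cdot>\<^bsub>G\<^esub> h)) else \<zero>\<^bsub>A\<^esub>)) \<and>
     (\<forall>g\<in>mor G. adj A (w g) = scl A (cnj (c g (minv G g))) (w (minv G g)))"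

text \<open>
  The condition \<open>w v = t v\<close> on the common objects \<open>v\<close> makes explicit that both maps restrict to the
  same map on \<open>\<G>\<^sup>0 = \<Lambda>\<^sup>0\<close>.  It does not follow from the other conditions: for the category with one
  morphism and \<open>A = \<complex>\<close>, they hold with \<open>t v = 1\<close> and \<open>w v = 0\<close>.  It is necessary for the existence of a
  homomorphism carrying the restrictions of one family on the product category to \<open>t\<close> and \<open>w\<close>.
\<close>

definition toeplitz_pair :: "'m cat \<Rightarrow> 'm kgraph \<Rightarrow> ('m \<Rightarrow> 'm \<Rightarrow> 'm) \<Rightarrow> ('m \<Rightarrow> 'm \<Rightarrow> 'm)
    \<Rightarrow> 'm total_cochain \<Rightarrow> 'a cstar \<Rightarrow> ('m \<Rightarrow> 'a) \<Rightarrow> ('m \<Rightarrow> 'a) \<Rightarrow> bool" where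
  "toeplitz_pair G \<Lambda> act res \<phi> A t w \<longleftrightarrow>
     graph_TCK_family \<Lambda> (phi02 \<phi>) A t \<and> unitary_rep G (phi20 \<phi>) A w \<and>
     (\<forall>v\<in>obj \<Lambda>. w v = t v) \<and>
     (\<forall>g\<in>mor G. \<forall>x\<in>mor \<Lambda>. src G g = rng \<Lambda> x \<longrightarrow>
        w g \<otimes>\<^bsub>A\<^esub> t x = scl A (phi11 \<phi> g x) (t (act g x) \<otimes>\<^bsub>A\<^esub> w (res g x)))"

definition cuntz_krieger_pair :: "'m cat \<Rightarrow> 'm kgraph \<Rightarrow> ('m \<Rightarrow> 'm \<Rightarrow> 'm) \<Rightarrow> ('m \<Rightarrow> 'm \<Rightarrow> 'm)
    \<Rightarrow> 'm total_cochain \<Rightarrow> 'a cstar \<Rightarrow> ('m \<Rightarrow> 'a) \<Rightarrow> ('m \<Rightarrow> 'a) \<Rightarrow> bool" where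
  "cuntz_krieger_pair G \<Lambda> act res \<phi> A t w \<longleftrightarrow>
     toeplitz_pair G \<Lambda> act res \<phi> A t w \<and> CK \<Lambda> A t"

end

theory Submission
  imports Defs
begin

text \<open>
  Every element of the product category factors as \<open>(x, g) = (x, s(x)) (r(g), g)\<close>, and the cocycle
  \<open>\<Psi>\<^sup>2(\<phi>)\<close> is trivial on such a pair.  A family on the product category is therefore determined by
  its restrictions through \<open>t\<^sub>x\<^sub>g = t\<^sub>x w\<^sub>g\<close>; conversely this formula turns a pair into a family, (T3)
  being what is needed to multiply two such products.
\<close>

section \<open>Scalars, zero products and sums of range projections in a C*-algebra\<close>

context cstar_algebra begin

lemma mult_zero_right: "x \<in> carrier A \<Longrightarrow> x \<otimes> \<zero> = \<zero>"
  using distr_right[of \<zero> \<zero> x] mult_closed[of x \<zero>] by (metis add.r_cancel_one' zero_closed l_zero)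

lemma mult_zero_left: "x \<in> carrier A \<Longrightarrow> \<zero> \<otimes> x = \<zero>"
  using distr_left[of \<zero> \<zero> x] mult_closed[of \<zero> x] by (metis add.r_cancel_one' zero_closed l_zero)

text \<open>Cocycle values have modulus one, so multiplying by the conjugate undoes the twist in a
  product relation.\<close>

lemma scl_unit_cancel: "\<lbrakk>x \<in> carrier A; cmod a = 1\<rbrakk> \<Longrightarrow> scl A (cnj a) (scl A a x) = x"
  by (simp add: scl_scl scl_one mult.commute[of "cnj a"] flip: complex_norm_square)

end

lemma finsum_range_proj_cong:
  assumes "cstar_algebra A" "\<And>x. x \<in> S \<Longrightarrow> t x \<in> carrier A" "\<And>x. x \<in> S \<Longrightarrow> t' x = t x"
  shows "(\<Oplus>\<^bsub>A\<^esub>x\<in>S. range_proj A (t' x)) = (\<Oplus>\<^bsub>A\<^esub>x\<in>S. range_proj A (t x))"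
proof -
  interpret cstar_algebra A by fact
  show ?thesis
    using assms(2,3) by (intro add.finprod_cong') (auto simp: range_proj_def mult_closed adj_closed)
qed

text \<open>Elements of \<open>MCE\<close> are morphisms by definition, so the relation sees only
  values on \<open>mor \<Lambda>\<close>. This matters because a map rebuilt from the product
  category agrees with the original one on morphisms only.\<close>

lemma TCK3_cong:
  assumes "cstar_algebra A" "t \<in> mor \<Lambda> \<rightarrow> carrier A" "\<And>x. x \<in> mor \<Lambda> \<Longrightarrow> t' x = t x"
  shows "TCK3 \<Lambda> A t' \<longleftrightarrow> TCK3 \<Lambda> A t"
proof -
  have "(\<Oplus>\<^bsub>A\<^esub>x\<in>MCE \<Lambda> \<mu> \<nu>. range_proj A (t' x)) = (\<Oplus>\<^bsub>A\<^esub>x\<in>MCE \<Lambda> \<mu> \<nu>. range_proj A (t x))" for \<mu> \<nu>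
    using assms by (intro finsum_range_proj_cong) (auto simp: MCE_def)
  then show ?thesis
    using assms(3) by (simp add: TCK3_def range_proj_def)
qed

text \<open>Besides range projections of paths, (CK) involves the value at the object
  \<open>v\<close> itself; the inclusion of \<open>obj \<Lambda>\<close> in
  \<open>mor \<Lambda>\<close> covers that value.\<close>

lemma CK_cong:
  assumes "cstar_algebra A" "t \<in> mor \<Lambda> \<rightarrow> carrier A" "\<And>x. x \<in> mor \<Lambda> \<Longrightarrow> t' x = t x"
    and "obj \<Lambda> \<subseteq> mor \<Lambda>"
  shows "CK \<Lambda> A t' \<longleftrightarrow> CK \<Lambda> A t"
proof -
  have "(\<Oplus>\<^bsub>A\<^esub>x\<in>paths_with_rng \<Lambda> v n. range_proj A (t' x))
      = (\<Oplus>\<^bsub>A\<^esub>x\<in>paths_with_rng \<Lambda> v n. range_proj A (t x))" for v n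
    using assms by (intro finsum_range_proj_cong) (auto simp: paths_with_rng_def)
  then show ?thesis
    using assms(3,4) by (auto simp: CK_def subset_iff)
qed

section \<open>Inverses in a groupoid\<close>

context groupoid begin

lemma is_inverse_minv:
  assumes "g \<in> mor G"
  shows "is_inverse G g (minv G g)"
proof -
  \<comment> \<open>The definite description in \<open>minv\<close> demands uniqueness:
    \<open>h = h (g h') = (h g) h' = h'\<close>.\<close>
  have "h = h'" if "is_inverse G g h" "is_inverse G g h'" for h h'
    using that assms cmp_assoc[of h g h'] unfolding is_inverse_def by (metis cmp_rng cmp_src)
  then have "\<exists>!h. is_inverse G g h"
    using invertible[OF assms] by blast
  then show ?thesis
    unfolding minv_def by (rule theI')
qed

lemma minv_closed: "g \<in> mor G \<Longrightarrow> minv G g \<in> mor G"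
  and src_minv: "g \<in> mor G \<Longrightarrow> src G (minv G g) = rng G g"
  and rng_minv: "g \<in> mor G \<Longrightarrow> rng G (minv G g) = src G g"
  and cmp_minv: "g \<in> mor G \<Longrightarrow> g \<cdot> minv G g = rng G g"
  and minv_cmp: "g \<in> mor G \<Longrightarrow> minv G g \<cdot> g = src G g"
  using is_inverse_minv by (auto simp: is_inverse_def)

end

section \<open>The total cocycle and the product category\<close>

locale twisted_self_similar_action = self_similar_action G \<Lambda> act res
  for G :: "'m cat" and \<Lambda> :: "'m kgraph" and act res :: "'m \<Rightarrow> 'm \<Rightarrow> 'm" +
  fixes \<phi> :: "'m total_cochain"
  assumes cocycle: "normalised_total_2_cocycle G \<Lambda> act res \<phi>"
begin

abbreviation E where "E \<equiv> ZS G \<Lambda> act res"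
abbreviation c where "c \<equiv> Psi2 act res \<phi>"

text \<open>Normalisation is phrased through \<open>obj G\<close> for all three components, so that
  the same facts about the common objects discharge every side condition.\<close>

lemma
  shows norm_phi20: "\<lbrakk>g \<in> mor G; h \<in> mor G; src G g = rng G h\<rbrakk> \<Longrightarrow> cmod (phi20 \<phi> g h) = 1"
    and phi20_cocycle: "\<lbrakk>g \<in> mor G; h \<in> mor G; k \<in> mor G; src G g = rng G h; src G h = rng G k\<rbrakk>
      \<Longrightarrow> phi20 \<phi> g h * phi20 \<phi> (g \<cdot>\<^bsub>G\<^esub> h) k = phi20 \<phi> h k * phi20 \<phi> g (h \<cdot>\<^bsub>G\<^esub> k)"
    and phi20_obj: "\<lbrakk>g \<in> mor G; h \<in> mor G; src G g = rng G h; g \<in> obj G \<or> h \<in> obj G\<rbrakk>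
      \<Longrightarrow> phi20 \<phi> g h = 1"
    and phi02_obj: "\<lbrakk>x \<in> mor \<Lambda>; y \<in> mor \<Lambda>; src \<Lambda> x = rng \<Lambda> y; x \<in> obj G \<or> y \<in> obj G\<rbrakk>
      \<Longrightarrow> phi02 \<phi> x y = 1"
    and phi11_obj: "\<lbrakk>g \<in> mor G; x \<in> mor \<Lambda>; src G g = rng \<Lambda> x; g \<in> obj G \<or> x \<in> obj G\<rbrakk>
      \<Longrightarrow> phi11 \<phi> g x = 1"
  using cocycle unfolding normalised_total_2_cocycle_def normalised_2_cocycle_def same_objects
  by (simp, blast, blast, blast, blast)

text \<open>In the cocycle identity at \<open>g\<close>, its inverse and \<open>g\<close> again, the
  two remaining factors have an identity as an argument. The symmetry is needed because (T2) uses
  one order of the arguments and the product of \<open>w (minv G g)\<close> with \<open>w g\<close>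
  the other.\<close>

lemma phi20_minv:
  assumes "g \<in> mor G"
  shows "phi20 \<phi> (minv G g) g = phi20 \<phi> g (minv G g)"
  using phi20_cocycle[of g "minv G g" g] assms
  by (simp add: G.minv_closed G.src_minv G.rng_minv G.cmp_minv G.minv_cmp phi20_obj ends ends_obj)

lemma objD:
  assumes "v \<in> obj G"
  shows "v \<in> mor G" "v \<in> mor \<Lambda>" "src G v = v" "rng G v = v" "src \<Lambda> v = v" "rng \<Lambda> v = v"
  using objG[OF assms] by auto

lemma obj_cmp_obj: "v \<in> obj G \<Longrightarrow> v \<cdot>\<^bsub>\<Lambda>\<^esub> v = v" "v \<in> obj G \<Longrightarrow> v \<cdot>\<^bsub>G\<^esub> v = v"
  using L.cmp_rng[of v] G.cmp_rng[of v] objD by auto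

lemma obj_subset: "obj \<Lambda> \<subseteq> mor \<Lambda>"
  using objD same_objects by auto

lemma ZS_simps [simp]:
  "(x, g) \<in> mor E \<longleftrightarrow> x \<in> mor \<Lambda> \<and> g \<in> mor G \<and> src \<Lambda> x = rng G g"
  "src E (x, g) = (src G g, src G g)"
  "rng E (x, g) = (rng \<Lambda> x, rng \<Lambda> x)"
  "(x, g) \<cdot>\<^bsub>E\<^esub> (y, h) = (x \<cdot>\<^bsub>\<Lambda>\<^esub> act g y, res g y \<cdot>\<^bsub>G\<^esub> h)"
  by (auto simp: ZS_def)

lemma incl_closed: "x \<in> mor \<Lambda> \<Longrightarrow> incl_graph \<Lambda> x \<in> mor E" "g \<in> mor G \<Longrightarrow> incl_grpd G g \<in> mor E"
  by (auto simp: incl_graph_def incl_grpd_def ends)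

text \<open>The two embeddings meet in the identities \<open>(v, v)\<close>, which is why the two
  restrictions of a family agree on objects.\<close>

lemma incl_obj: "v \<in> obj G \<Longrightarrow> incl_graph \<Lambda> v = (v, v)" "v \<in> obj G \<Longrightarrow> incl_grpd G v = (v, v)"
  by (simp_all add: incl_graph_def incl_grpd_def objD)

end

section \<open>From a family on the product category to a pair\<close>

locale twisted_family = twisted_self_similar_action G \<Lambda> act res \<phi> + A: cstar_algebra A
  for G :: "'m cat" and \<Lambda> :: "'m kgraph" and act res :: "'m \<Rightarrow> 'm \<Rightarrow> 'm"
    and \<phi> :: "'m total_cochain" and A :: "'a cstar" +
  fixes t
  assumes family: "TCK_family G \<Lambda> act res (Psi2 act res \<phi>) A t"
begin

abbreviation tt where "tt x \<equiv> t (incl_graph \<Lambda> x)"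
abbreviation ww where "ww g \<equiv> t (incl_grpd G g)"

lemma
  shows family_closed: "\<zeta> \<in> mor E \<Longrightarrow> t \<zeta> \<in> carrier A"
    and family_mult: "\<lbrakk>\<zeta> \<in> mor E; \<eta> \<in> mor E; src E \<zeta> = rng E \<eta>\<rbrakk>
      \<Longrightarrow> t \<zeta> \<otimes>\<^bsub>A\<^esub> t \<eta> = scl A (c \<zeta> \<eta>) (t (\<zeta> \<cdot>\<^bsub>E\<^esub> \<eta>))"
    and family_orth: "\<lbrakk>\<zeta> \<in> mor E; \<eta> \<in> mor E; src E \<zeta> \<noteq> rng E \<eta>\<rbrakk> \<Longrightarrow> t \<zeta> \<otimes>\<^bsub>A\<^esub> t \<eta> = \<zero>\<^bsub>A\<^esub>"
    and family_adj: "\<zeta> \<in> mor E \<Longrightarrow> adj A (t \<zeta>) \<otimes>\<^bsub>A\<^esub> t \<zeta> = t (src E \<zeta>)"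
    and family_TCK3: "TCK3 \<Lambda> A tt"
  using family unfolding TCK_family_def Let_def by auto

lemma tt_closed: "x \<in> mor \<Lambda> \<Longrightarrow> tt x \<in> carrier A"
  and ww_closed: "g \<in> mor G \<Longrightarrow> ww g \<in> carrier A"
  by (simp_all add: incl_closed family_closed)

text \<open>With \<open>v = rng G g = src \<Lambda> x\<close>, each of the three factors of
  \<open>Psi2\<close> has \<open>v\<close> as an argument and so equals 1, while \<open>v\<close>
  acts trivially on itself.\<close>

lemma tt_ww:
  assumes "x \<in> mor \<Lambda>" "g \<in> mor G" "src \<Lambda> x = rng G g"
  shows "tt x \<otimes>\<^bsub>A\<^esub> ww g = t (x, g)"
proof -
  have v: "rng G g \<in> obj G" using assms by (simp add: ends_obj)
  have "act (rng G g) (rng G g) = rng G g" "res (rng G g) (rng G g) = rng G g"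
    using act_rng[of "rng G g"] res_rng[of "rng G g"] objD[OF v] by auto
  moreover have "x \<cdot>\<^bsub>\<Lambda>\<^esub> rng G g = x"
    using L.cmp_src[OF assms(1)] assms by simp
  ultimately show ?thesis
    using assms v objD[OF v]
    by (simp add: incl_graph_def incl_grpd_def family_mult Psi2_def phi20_obj phi02_obj phi11_obj
        G.cmp_rng A.scl_one family_closed)
qed

text \<open>The composite of the two embedded elements is \<open>(act g x, res g x)\<close>. In
  \<open>Psi2\<close> the outer factors are normalised away, leaving \<open>phi11\<close>;
  \<open>tt_ww\<close> then splits the composite into the product on the right.\<close>

lemma ww_tt:
  assumes "g \<in> mor G" "x \<in> mor \<Lambda>" "src G g = rng \<Lambda> x"
  shows "ww g \<otimes>\<^bsub>A\<^esub> tt x = scl A (phi11 \<phi> g x) (tt (act g x) \<otimes>\<^bsub>A\<^esub> ww (res g x))"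
proof -
  have "rng G g \<cdot>\<^bsub>\<Lambda>\<^esub> act g x = act g x"
    using L.cmp_rng[of "act g x"] assms by (simp add: act_closed rng_act)
  moreover have "res g x \<cdot>\<^bsub>G\<^esub> src \<Lambda> x = res g x"
    using G.cmp_src[of "res g x"] assms by (simp add: res_closed src_res)
  moreover have "c (incl_grpd G g) (incl_graph \<Lambda> x) = phi11 \<phi> g x"
    using assms by (simp add: Psi2_def incl_grpd_def incl_graph_def phi20_obj phi02_obj ends ends_obj
        act_closed res_closed rng_act src_res)
  ultimately show ?thesis
    using assms by (subst tt_ww)
      (simp_all add: act_closed res_closed src_act family_mult incl_closed,
       simp_all add: incl_grpd_def incl_graph_def family_mult ends)
qed

text \<open>At the identity \<open>(v, v)\<close>, (TCK2) exhibits the element as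
  \<open>a* a\<close>, which is self-adjoint.\<close>

lemma tt_obj_self_adjoint:
  assumes "v \<in> obj G"
  shows "adj A (tt v) = tt v"
proof -
  have "(v, v) \<in> mor E" using objD[OF assms] by simp
  then have "adj A (t (v, v)) \<otimes>\<^bsub>A\<^esub> t (v, v) = t (v, v)" "t (v, v) \<in> carrier A"
    using family_adj[of "(v, v)"] family_closed objD[OF assms] by auto
  then show ?thesis
    using A.adj_mult A.adj_adj A.adj_closed incl_obj assms by metis
qed

lemma tt_mult:
  assumes "x \<in> mor \<Lambda>" "y \<in> mor \<Lambda>" "src \<Lambda> x = rng \<Lambda> y"
  shows "tt x \<otimes>\<^bsub>A\<^esub> tt y = scl A (phi02 \<phi> x y) (tt (x \<cdot>\<^bsub>\<Lambda>\<^esub> y))"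
  using assms
  by (simp add: incl_graph_def family_mult Psi2_def ends ends_obj act_rng res_rng phi20_obj phi11_obj
      L.src_cmp obj_cmp_obj)

lemma graph_family: "graph_TCK_family \<Lambda> (phi02 \<phi>) A tt"
  unfolding graph_TCK_family_def
proof (intro conjI ballI impI)
  show "tt \<in> mor \<Lambda> \<rightarrow> carrier A" by (simp add: tt_closed)
  show "TCK3 \<Lambda> A tt" by (rule family_TCK3)
  show "tt x \<otimes>\<^bsub>A\<^esub> tt y = scl A (phi02 \<phi> x y) (tt (x \<cdot>\<^bsub>\<Lambda>\<^esub> y))"
    if "x \<in> mor \<Lambda>" "y \<in> mor \<Lambda>" "src \<Lambda> x = rng \<Lambda> y" for x y
    using that by (rule tt_mult)
  show "adj A (tt x) \<otimes>\<^bsub>A\<^esub> tt x = tt (src \<Lambda> x)" if "x \<in> mor \<Lambda>" for x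
    using that by (simp add: family_adj incl_closed) (simp add: incl_graph_def ends)
next
  fix v assume v: "v \<in> obj \<Lambda>"
  then show "adj A (tt v) = tt v" using tt_obj_self_adjoint same_objects by simp
  have "v \<in> obj G" using v same_objects by simp
  note o = objD[OF this] obj_cmp_obj[OF this] this
  then show "tt v \<otimes>\<^bsub>A\<^esub> tt v = tt v"
    using tt_mult[of v v] by (simp add: phi02_obj A.scl_one tt_closed)
  \<comment> \<open>Distinct objects give identities \<open>(v, v)\<close> and \<open>(w, w)\<close>
    that are not composable, so (TCK1) makes the product vanish.\<close>
  fix w assume "w \<in> obj \<Lambda>" "v \<noteq> w"
  then show "tt v \<otimes>\<^bsub>A\<^esub> tt w = \<zero>\<^bsub>A\<^esub>"
    using o objD[of w] same_objects incl_obj by (simp add: family_orth)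
qed

lemma ww_mult:
  assumes "g \<in> mor G" "h \<in> mor G" "src G g = rng G h"
  shows "ww g \<otimes>\<^bsub>A\<^esub> ww h = scl A (phi20 \<phi> g h) (ww (g \<cdot>\<^bsub>G\<^esub> h))"
proof -
  \<comment> \<open>Composability makes \<open>rng G h\<close> the source of \<open>g\<close>, where
    both actions are trivial; only the \<open>phi20\<close> factor of \<open>Psi2\<close>
    survives.\<close>
  have "act g (rng G h) = rng G g" "res g (rng G h) = g"
    using act_src[of g] res_src[of g] assms by auto
  then show ?thesis
    using assms
    by (simp add: incl_grpd_def family_mult Psi2_def ends ends_obj phi02_obj phi11_obj G.rng_cmp
        obj_cmp_obj)
qed

text \<open>A family prescribes \<open>w* w\<close> but not \<open>w*\<close> itself. The adjoint is
  recovered by multiplying it on the right by the unit \<open>ww (rng G g)\<close>, written as a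
  scalar multiple of \<open>ww g\<close> times \<open>ww (minv G g)\<close>; then (TCK2) collapses
  \<open>w* w\<close> to a unit for \<open>ww (minv G g)\<close>.\<close>

lemma ww_adj:
  assumes g: "g \<in> mor G"
  shows "adj A (ww g) = scl A (cnj (phi20 \<phi> g (minv G g))) (ww (minv G g))"
proof -
  let ?h = "minv G g" and ?a = "phi20 \<phi> g (minv G g)"
  note h = G.minv_closed[OF g] G.src_minv[OF g] G.rng_minv[OF g] G.cmp_minv[OF g]
  have cl: "ww g \<in> carrier A" "ww ?h \<in> carrier A" "ww (rng G g) \<in> carrier A"
    "adj A (ww g) \<in> carrier A"
    using g h by (auto simp: ww_closed ends A.adj_closed)
  have a: "cmod ?a = 1" using g h by (simp add: norm_phi20)
  have "ww (rng G g) \<otimes>\<^bsub>A\<^esub> ww g = ww g"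
    using g by (simp add: ww_mult ends ends_obj phi20_obj G.cmp_rng A.scl_one ww_closed)
  moreover have "adj A (ww (rng G g)) = ww (rng G g)"
    using g tt_obj_self_adjoint[of "rng G g"] by (simp add: ends_obj incl_obj)
  ultimately have "adj A (ww g) = adj A (ww g) \<otimes>\<^bsub>A\<^esub> ww (rng G g)"
    using A.adj_mult cl by metis
  also have "ww (rng G g) = scl A (cnj ?a) (ww g \<otimes>\<^bsub>A\<^esub> ww ?h)"
    using g h a cl by (simp add: ww_mult A.scl_unit_cancel)
  also have "adj A (ww g) \<otimes>\<^bsub>A\<^esub> \<dots> = scl A (cnj ?a) ((adj A (ww g) \<otimes>\<^bsub>A\<^esub> ww g) \<otimes>\<^bsub>A\<^esub> ww ?h)"
    using cl by (simp add: A.scl_mult_right A.mult_assoc A.mult_closed)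
  also have "adj A (ww g) \<otimes>\<^bsub>A\<^esub> ww g = ww (src G g)"
    using g by (simp add: family_adj incl_closed) (simp add: incl_grpd_def ends)
  also have "ww (src G g) \<otimes>\<^bsub>A\<^esub> ww ?h = ww ?h"
    using g h G.cmp_rng[of ?h] cl by (simp add: ww_mult ends ends_obj phi20_obj A.scl_one)
  finally show ?thesis .
qed

lemma grpd_rep: "unitary_rep G (phi20 \<phi>) A ww"
proof -
  have "ww g \<otimes>\<^bsub>A\<^esub> ww h = \<zero>\<^bsub>A\<^esub>" if "g \<in> mor G" "h \<in> mor G" "src G g \<noteq> rng G h" for g h
    using that by (intro family_orth) (auto simp: incl_grpd_def ends)
  then show ?thesis
    by (simp add: unitary_rep_def ww_closed ww_mult ww_adj)
qed

lemma pair: "toeplitz_pair G \<Lambda> act res \<phi> A tt ww"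
  unfolding toeplitz_pair_def
  using graph_family grpd_rep ww_tt same_objects incl_obj by auto

text \<open>By \<open>tt_ww\<close>, a subalgebra containing both restrictions contains their
  products, hence the whole family; the converse holds because the restrictions are values of the
  family. So both sides intersect the same collection of closed subalgebras.\<close>

lemma generated_by_pair: "cstar_generated A (tt ` mor \<Lambda> \<union> ww ` mor G) = cstar_generated A (t ` mor E)"
proof -
  have "tt ` mor \<Lambda> \<union> ww ` mor G \<subseteq> S \<longleftrightarrow> t ` mor E \<subseteq> S" if S: "cstar_subalgebra A S" for S
  proof
    assume *: "tt ` mor \<Lambda> \<union> ww ` mor G \<subseteq> S"
    have "t \<zeta> \<in> S" if "\<zeta> \<in> mor E" for \<zeta>
    proof -
      obtain x g where \<zeta>: "\<zeta> = (x, g)" by fastforce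
      with that have "tt x \<in> S" "ww g \<in> S" "t \<zeta> = tt x \<otimes>\<^bsub>A\<^esub> ww g"
        using * by (auto simp: tt_ww)
      then show ?thesis using S by (simp add: cstar_subalgebra_def)
    qed
    then show "t ` mor E \<subseteq> S" by blast
  qed (use incl_closed in blast)
  then show ?thesis
    unfolding cstar_generated_def by (metis (lifting))
qed

end

section \<open>From a pair to a family on the product category\<close>

locale twisted_pair = twisted_self_similar_action G \<Lambda> act res \<phi> + A: cstar_algebra A
  for G :: "'m cat" and \<Lambda> :: "'m kgraph" and act res :: "'m \<Rightarrow> 'm \<Rightarrow> 'm"
    and \<phi> :: "'m total_cochain" and A :: "'a cstar" +
  fixes t w
  assumes pair: "toeplitz_pair G \<Lambda> act res \<phi> A t w"
begin

lemma
  shows t_closed: "x \<in> mor \<Lambda> \<Longrightarrow> t x \<in> carrier A"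
    and t_obj_orth: "\<lbrakk>u \<in> obj G; v \<in> obj G; u \<noteq> v\<rbrakk> \<Longrightarrow> t u \<otimes>\<^bsub>A\<^esub> t v = \<zero>\<^bsub>A\<^esub>"
    and t_mult: "\<lbrakk>x \<in> mor \<Lambda>; y \<in> mor \<Lambda>; src \<Lambda> x = rng \<Lambda> y\<rbrakk>
      \<Longrightarrow> t x \<otimes>\<^bsub>A\<^esub> t y = scl A (phi02 \<phi> x y) (t (x \<cdot>\<^bsub>\<Lambda>\<^esub> y))"
    and t_adj: "x \<in> mor \<Lambda> \<Longrightarrow> adj A (t x) \<otimes>\<^bsub>A\<^esub> t x = t (src \<Lambda> x)"
    and t_TCK3: "TCK3 \<Lambda> A t"
    and w_closed: "g \<in> mor G \<Longrightarrow> w g \<in> carrier A"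
    and w_mult: "\<lbrakk>g \<in> mor G; h \<in> mor G; src G g = rng G h\<rbrakk>
      \<Longrightarrow> w g \<otimes>\<^bsub>A\<^esub> w h = scl A (phi20 \<phi> g h) (w (g \<cdot>\<^bsub>G\<^esub> h))"
    and w_adj: "g \<in> mor G \<Longrightarrow> adj A (w g) = scl A (cnj (phi20 \<phi> g (minv G g))) (w (minv G g))"
    and w_obj: "v \<in> obj G \<Longrightarrow> w v = t v"
    and w_t: "\<lbrakk>g \<in> mor G; x \<in> mor \<Lambda>; src G g = rng \<Lambda> x\<rbrakk>
      \<Longrightarrow> w g \<otimes>\<^bsub>A\<^esub> t x = scl A (phi11 \<phi> g x) (t (act g x) \<otimes>\<^bsub>A\<^esub> w (res g x))"
  using pair unfolding toeplitz_pair_def graph_TCK_family_def unitary_rep_def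
  by (auto simp: same_objects)

abbreviation tw where "tw \<equiv> \<lambda>(x, g). t x \<otimes>\<^bsub>A\<^esub> w g"

lemma t_unit:
  assumes "x \<in> mor \<Lambda>"
  shows "t (rng \<Lambda> x) \<otimes>\<^bsub>A\<^esub> t x = t x" "t x \<otimes>\<^bsub>A\<^esub> t (src \<Lambda> x) = t x"
  using assms by (simp_all add: t_mult ends ends_obj phi02_obj L.cmp_rng L.cmp_src A.scl_one t_closed)

text \<open>Since \<open>w\<close> and \<open>t\<close> agree on objects, the vertex projections of
  \<open>t\<close> are also the units for \<open>w\<close>. This is what links the two halves of the
  pair.\<close>

lemma w_unit:
  assumes "g \<in> mor G"
  shows "t (rng G g) \<otimes>\<^bsub>A\<^esub> w g = w g" "w g \<otimes>\<^bsub>A\<^esub> t (src G g) = w g"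
  using assms
  by (simp_all add: w_mult ends ends_obj phi20_obj G.cmp_rng G.cmp_src A.scl_one w_closed
      flip: w_obj)

text \<open>(T3) covers composable arguments only. Otherwise the units at \<open>src G g\<close> and
  \<open>rng \<Lambda> x\<close> are inserted between the factors, and these projections are
  orthogonal.\<close>

lemma w_t_orth:
  assumes "g \<in> mor G" "x \<in> mor \<Lambda>" "src G g \<noteq> rng \<Lambda> x"
  shows "w g \<otimes>\<^bsub>A\<^esub> t x = \<zero>\<^bsub>A\<^esub>"
proof -
  have cl: "w g \<in> carrier A" "t x \<in> carrier A" "t (src G g) \<in> carrier A" "t (rng \<Lambda> x) \<in> carrier A"
    using assms by (auto simp: t_closed w_closed ends)
  have "w g \<otimes>\<^bsub>A\<^esub> t x = (w g \<otimes>\<^bsub>A\<^esub> t (src G g)) \<otimes>\<^bsub>A\<^esub> (t (rng \<Lambda> x) \<otimes>\<^bsub>A\<^esub> t x)"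
    using assms by (simp add: w_unit t_unit)
  also have "\<dots> = w g \<otimes>\<^bsub>A\<^esub> ((t (src G g) \<otimes>\<^bsub>A\<^esub> t (rng \<Lambda> x)) \<otimes>\<^bsub>A\<^esub> t x)"
    using cl by (simp add: A.mult_assoc A.mult_closed)
  also have "t (src G g) \<otimes>\<^bsub>A\<^esub> t (rng \<Lambda> x) = \<zero>\<^bsub>A\<^esub>"
    using assms by (simp add: t_obj_orth ends_obj)
  finally show ?thesis using cl by (simp add: A.mult_zero_left A.mult_zero_right)
qed

text \<open>Replacing the adjoint by means of (T2) produces a conjugate value of
  \<open>phi20\<close>, and the product with \<open>w g\<close> a second value. By
  \<open>phi20_minv\<close> they belong to the same number of modulus one and cancel.\<close>

lemma w_adj_w:
  assumes g: "g \<in> mor G"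
  shows "adj A (w g) \<otimes>\<^bsub>A\<^esub> w g = t (src G g)"
proof -
  note h = G.minv_closed[OF g] G.src_minv[OF g] G.rng_minv[OF g] G.minv_cmp[OF g]
  have "cmod (phi20 \<phi> g (minv G g)) = 1" using g h by (simp add: norm_phi20)
  moreover have "t (src G g) \<in> carrier A" using g by (simp add: t_closed ends)
  ultimately show ?thesis
    using g h
    by (simp add: w_adj A.scl_mult_left w_closed w_mult phi20_minv w_obj ends_obj A.scl_unit_cancel)
qed

text \<open>The second factor sits at an object and is absorbed as a unit. With
  \<open>tw_grpd\<close> this ensures that a homomorphism matching \<open>tw\<close> restricts to
  the given pair.\<close>

lemma tw_graph: "x \<in> mor \<Lambda> \<Longrightarrow> tw (incl_graph \<Lambda> x) = t x"
  by (simp add: incl_graph_def w_obj ends_obj t_unit)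

lemma tw_grpd: "g \<in> mor G \<Longrightarrow> tw (incl_grpd G g) = w g"
  by (simp add: incl_grpd_def w_unit)

text \<open>(T3) moves \<open>w g\<close> past \<open>t y\<close>, after which (T1) merges the two
  graph factors and (T2) the two groupoid factors. The scalars so collected are the three factors of
  \<open>Psi2\<close>.\<close>

lemma tw_mult:
  assumes "x \<in> mor \<Lambda>" "g \<in> mor G" "src \<Lambda> x = rng G g"
    and "y \<in> mor \<Lambda>" "h \<in> mor G" "src \<Lambda> y = rng G h" "src G g = rng \<Lambda> y"
  shows "tw (x, g) \<otimes>\<^bsub>A\<^esub> tw (y, h) = scl A (c (x, g) (y, h)) (tw ((x, g) \<cdot>\<^bsub>E\<^esub> (y, h)))"
proof -
  let ?y = "act g y" and ?g = "res g y"
  have m: "?y \<in> mor \<Lambda>" "?g \<in> mor G" "src \<Lambda> x = rng \<Lambda> ?y" "src G ?g = rng G h"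
    using assms by (auto simp: act_closed res_closed rng_act src_res)
  have cl: "t x \<in> carrier A" "t y \<in> carrier A" "t ?y \<in> carrier A" "w g \<in> carrier A"
    "w h \<in> carrier A" "w ?g \<in> carrier A" "t (x \<cdot>\<^bsub>\<Lambda>\<^esub> ?y) \<in> carrier A" "w (?g \<cdot>\<^bsub>G\<^esub> h) \<in> carrier A"
    using assms m by (auto simp: t_closed w_closed L.cmp_closed G.cmp_closed)
  have "(t x \<otimes>\<^bsub>A\<^esub> w g) \<otimes>\<^bsub>A\<^esub> (t y \<otimes>\<^bsub>A\<^esub> w h) = t x \<otimes>\<^bsub>A\<^esub> ((w g \<otimes>\<^bsub>A\<^esub> t y) \<otimes>\<^bsub>A\<^esub> w h)"
    using cl by (simp add: A.mult_assoc A.mult_closed)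
  also have "\<dots> = scl A (phi11 \<phi> g y) ((t x \<otimes>\<^bsub>A\<^esub> t ?y) \<otimes>\<^bsub>A\<^esub> (w ?g \<otimes>\<^bsub>A\<^esub> w h))"
    using assms cl
    by (simp add: w_t A.scl_mult_left A.scl_mult_right A.mult_assoc A.mult_closed)
  also have "\<dots> = scl A (c (x, g) (y, h)) (t (x \<cdot>\<^bsub>\<Lambda>\<^esub> ?y) \<otimes>\<^bsub>A\<^esub> w (?g \<cdot>\<^bsub>G\<^esub> h))"
    using assms m cl
    by (simp add: t_mult w_mult A.scl_mult_left A.scl_mult_right A.scl_scl A.scl_closed A.mult_closed
        Psi2_def mult_ac)
  finally show ?thesis by simp
qed

lemma tw_orth:
  assumes "x \<in> mor \<Lambda>" "g \<in> mor G" "y \<in> mor \<Lambda>" "h \<in> mor G" "src G g \<noteq> rng \<Lambda> y"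
  shows "tw (x, g) \<otimes>\<^bsub>A\<^esub> tw (y, h) = \<zero>\<^bsub>A\<^esub>"
proof -
  have cl: "t x \<in> carrier A" "t y \<in> carrier A" "w g \<in> carrier A" "w h \<in> carrier A"
    using assms by (auto simp: t_closed w_closed)
  then have "(t x \<otimes>\<^bsub>A\<^esub> w g) \<otimes>\<^bsub>A\<^esub> (t y \<otimes>\<^bsub>A\<^esub> w h) = t x \<otimes>\<^bsub>A\<^esub> ((w g \<otimes>\<^bsub>A\<^esub> t y) \<otimes>\<^bsub>A\<^esub> w h)"
    by (simp add: A.mult_assoc A.mult_closed)
  then show ?thesis
    using assms cl by (simp add: w_t_orth A.mult_zero_left A.mult_zero_right)
qed

text \<open>The inner product of \<open>t x\<close> with its adjoint is the projection at
  \<open>src \<Lambda> x = rng G g\<close>, a left unit for \<open>w g\<close>; what remains is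
  \<open>w_adj_w\<close>.\<close>

lemma tw_adj:
  assumes "x \<in> mor \<Lambda>" "g \<in> mor G" "src \<Lambda> x = rng G g"
  shows "adj A (tw (x, g)) \<otimes>\<^bsub>A\<^esub> tw (x, g) = tw (src E (x, g))"
proof -
  have cl: "t x \<in> carrier A" "w g \<in> carrier A" "adj A (t x) \<in> carrier A" "adj A (w g) \<in> carrier A"
    using assms by (auto simp: t_closed w_closed A.adj_closed)
  have "adj A (t x \<otimes>\<^bsub>A\<^esub> w g) \<otimes>\<^bsub>A\<^esub> (t x \<otimes>\<^bsub>A\<^esub> w g)
      = adj A (w g) \<otimes>\<^bsub>A\<^esub> ((adj A (t x) \<otimes>\<^bsub>A\<^esub> t x) \<otimes>\<^bsub>A\<^esub> w g)"
    using cl by (simp add: A.adj_mult A.mult_assoc A.mult_closed)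
  also have "\<dots> = t (src G g)"
    using assms by (simp add: t_adj w_unit w_adj_w)
  also have "\<dots> = tw (src E (x, g))"
    using tw_graph[of "src G g"] assms by (simp add: incl_obj ends ends_obj)
  finally show ?thesis by simp
qed

lemma family: "TCK_family G \<Lambda> act res c A tw"
proof -
  have "tw \<in> mor E \<rightarrow> carrier A"
    by (auto simp: A.mult_closed t_closed w_closed)
  moreover have "tw \<zeta> \<otimes>\<^bsub>A\<^esub> tw \<eta> =
      (if src E \<zeta> = rng E \<eta> then scl A (c \<zeta> \<eta>) (tw (\<zeta> \<cdot>\<^bsub>E\<^esub> \<eta>)) else \<zero>\<^bsub>A\<^esub>)"
    if "\<zeta> \<in> mor E" "\<eta> \<in> mor E" for \<zeta> \<eta>
    \<comment> \<open>Composition and \<open>tw\<close> on explicit pairs stay folded, so that the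
      goal keeps the shape of \<open>tw_mult\<close> and \<open>tw_orth\<close>.\<close>
    using that tw_mult tw_orth by (cases \<zeta>; cases \<eta>) (simp del: ZS_simps(4) split_conv)
  moreover have "adj A (tw \<zeta>) \<otimes>\<^bsub>A\<^esub> tw \<zeta> = tw (src E \<zeta>)" if "\<zeta> \<in> mor E" for \<zeta>
    using that tw_adj by (cases \<zeta>) (simp del: ZS_simps(2) split_conv)
  moreover have "TCK3 \<Lambda> A (\<lambda>x. tw (incl_graph \<Lambda> x))"
    using TCK3_cong[of A t \<Lambda> "\<lambda>x. tw (incl_graph \<Lambda> x)"] A.cstar_algebra_axioms t_TCK3 t_closed
      tw_graph by blast
  ultimately show ?thesis
    unfolding TCK_family_def Let_def by blast
qed

text \<open>(CK) concerns only the restriction to the graph, and by \<open>tw_graph\<close> that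
  restriction is \<open>t\<close> on morphisms.\<close>

lemma CK_family:
  assumes "CK \<Lambda> A t"
  shows "CK_family G \<Lambda> act res c A tw"
  using CK_cong[of A t \<Lambda> "\<lambda>x. tw (incl_graph \<Lambda> x)"] A.cstar_algebra_axioms t_closed tw_graph
    obj_subset assms family unfolding CK_family_def by blast

end

section \<open>Transfer of universality from families to pairs\<close>

theorem theorem7p15:
  fixes G :: "'m cat" and \<Lambda> :: "'m kgraph" and act res :: "'m \<Rightarrow> 'm \<Rightarrow> 'm"
    and \<phi> :: "'m total_cochain" and c :: "'m \<times> 'm \<Rightarrow> 'm \<times> 'm \<Rightarrow> complex"
  assumes "self_similar_action G \<Lambda> act res"
    and "row_finite_no_sources \<Lambda>"
    and "normalised_total_2_cocycle G \<Lambda> act res \<phi>"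
    and "c = Psi2 act res \<phi>"
  shows "(\<forall>(TA :: 'b cstar) t. universal_TCK_family TYPE('a) G \<Lambda> act res c TA t \<longrightarrow>
      (let tt = (\<lambda>x. t (incl_graph \<Lambda> x)); ww = (\<lambda>g. t (incl_grpd G g)) in
        toeplitz_pair G \<Lambda> act res \<phi> TA tt ww \<and>
        cstar_generated TA (tt ` mor \<Lambda> \<union> ww ` mor G) = carrier TA \<and>
        (\<forall>(A :: 'a cstar) t' w'. cstar_algebra A \<and> toeplitz_pair G \<Lambda> act res \<phi> A t' w' \<longrightarrow>
          (\<exists>\<rho>. star_hom TA A \<rho> \<and>
            (\<forall>x\<in>mor \<Lambda>. \<rho> (tt x) = t' x) \<and> (\<forall>g\<in>mor G. \<rho> (ww g) = w' g)))))
    \<and> (\<forall>(CA :: 'b cstar) s. universal_CK_family TYPE('a) G \<Lambda> act res c CA s \<longrightarrow>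
      (let ss = (\<lambda>x. s (incl_graph \<Lambda> x)); uu = (\<lambda>g. s (incl_grpd G g)) in
        cuntz_krieger_pair G \<Lambda> act res \<phi> CA ss uu \<and>
        cstar_generated CA (ss ` mor \<Lambda> \<union> uu ` mor G) = carrier CA \<and>
        (\<forall>(A :: 'a cstar) s' u'. cstar_algebra A \<and> cuntz_krieger_pair G \<Lambda> act res \<phi> A s' u' \<longrightarrow>
          (\<exists>\<rho>. star_hom CA A \<rho> \<and>
            (\<forall>x\<in>mor \<Lambda>. \<rho> (ss x) = s' x) \<and> (\<forall>g\<in>mor G. \<rho> (uu g) = u' g)))))"
proof (intro conjI allI impI, goal_cases)
  interpret twisted_self_similar_action G \<Lambda> act res \<phi>
    using assms by (simp add: twisted_self_similar_action_def twisted_self_similar_action_axioms_def)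
  {
    case (1 TA t)
    note U = 1[unfolded universal_TCK_family_def assms(4)]
    interpret F: twisted_family G \<Lambda> act res \<phi> TA t
      using U by (intro twisted_family.intro twisted_family_axioms.intro
          twisted_self_similar_action_axioms) auto
    have "\<exists>\<rho>. star_hom TA A \<rho> \<and> (\<forall>x\<in>mor \<Lambda>. \<rho> (F.tt x) = t' x) \<and> (\<forall>g\<in>mor G. \<rho> (F.ww g) = w' g)"
      if A: "cstar_algebra A" "toeplitz_pair G \<Lambda> act res \<phi> A t' w'" for A :: "'a cstar" and t' w'
    proof -
      interpret P: twisted_pair G \<Lambda> act res \<phi> A t' w'
        using A by (intro twisted_pair.intro twisted_pair_axioms.intro
            twisted_self_similar_action_axioms)
      \<comment> \<open>Universality is applied to the family \<open>tw\<close> built from the given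
        pair; evaluating at embedded elements then returns \<open>t'\<close> and
        \<open>w'\<close>.\<close>
      obtain \<rho> where "star_hom TA A \<rho>" "\<forall>\<zeta>\<in>mor E. \<rho> (t \<zeta>) = P.tw \<zeta>"
        using U A(1) P.family by blast
      then show ?thesis
        using incl_closed P.tw_graph P.tw_grpd by metis
    qed
    then show ?case
      using F.pair F.generated_by_pair U by (simp add: Let_def)
  next
    case (2 CA s)
    note U = 2[unfolded universal_CK_family_def assms(4)]
    interpret F: twisted_family G \<Lambda> act res \<phi> CA s
      \<comment> \<open>A Cuntz-Krieger family is in particular a Toeplitz one, so the restriction
        results apply to \<open>s\<close> as they stand.\<close>
      using U by (intro twisted_family.intro twisted_family_axioms.intro
          twisted_self_similar_action_axioms) (auto simp: CK_family_def)
    have "\<exists>\<rho>. star_hom CA A \<rho> \<and> (\<forall>x\<in>mor \<Lambda>. \<rho> (F.tt x) = s' x) \<and> (\<forall>g\<in>mor G. \<rho> (F.ww g) = u' g)"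
      if A: "cstar_algebra A" "cuntz_krieger_pair G \<Lambda> act res \<phi> A s' u'" for A :: "'a cstar" and s' u'
    proof -
      interpret P: twisted_pair G \<Lambda> act res \<phi> A s' u'
        using A by (intro twisted_pair.intro twisted_pair_axioms.intro
            twisted_self_similar_action_axioms) (auto simp: cuntz_krieger_pair_def)
      \<comment> \<open>Here (CK) for the pair is what makes \<open>tw\<close> an admissible target
        for the Cuntz-Krieger universal property.\<close>
      obtain \<rho> where "star_hom CA A \<rho>" "\<forall>\<zeta>\<in>mor E. \<rho> (s \<zeta>) = P.tw \<zeta>"
        using U A P.CK_family unfolding cuntz_krieger_pair_def by blast
      then show ?thesis
        using incl_closed P.tw_graph P.tw_grpd by metis
    qed
    then show ?case
      \<comment> \<open>(CK) for the restricted pair is literally the (CK) clause of the family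
        \<open>s\<close>.\<close>
      using F.pair F.generated_by_pair U by (simp add: Let_def cuntz_krieger_pair_def CK_family_def)
  }
qed

end
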